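(* If $G$ is a finite group, $k$ is a field, and $V$ is a faithful representation of $G$ over $k$ of finite dimension $n\geq 1$, then $$D_{\mathrm{span}}(G,V) \geq D_{\mathrm{reg}}(G,V) \geq \sqrt[n]{n!\,|G|}-\frac{n+1}{2}.$$
   Context: $k[V]$ is the ring of polynomial functions on $V$ (the symmetric algebra of $V^*$), with $G$-action $(gf)(v)=f(g^{-1}v)$; $k(V)$ is its fraction field and $k(V)^G$ the field of $G$-invariant rational functions; $k[V]_{\le d}$ is the space of polynomials of degree at most $d$. All minima are over $d\in\mathbb{N}=\{0,1,2,\dots\}$. $D_{\mathrm{reg}}(G,V)$ is the minimum $d$ such that $k[V]_{\le d}$ contains a $kG$-submodule isomorphic to the regular representation $kG$. $D_{\mathrm{span}}(G,V)$ is the minimum $d$ such that $k[V]_{\le d}$ spans $k(V)$ as a $k(V)^G$-vector space. *)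

theory Defs
  imports
    Complex_Main
    "HOL-Library.Poly_Mapping"
    "HOL-Computational_Algebra.Fraction_Field"
    "HOL-Algebra.Coset"
begin

section \<open>Representations and bases\<close>

locale linear_rep = group G + vector_space scale
  for G :: "('g, 'm) monoid_scheme" (structure)
    and scale :: "'k::field \<Rightarrow> 'v::ab_group_add \<Rightarrow> 'v" +
  fixes \<rho> :: "'g \<Rightarrow> 'v \<Rightarrow> 'v"
  assumes rho_linear: "g \<in> carrier G \<Longrightarrow> Vector_Spaces.linear scale scale (\<rho> g)"
    and rho_one: "\<rho> \<one> = id"
    and rho_mult: "g \<in> carrier G \<Longrightarrow> h \<in> carrier G \<Longrightarrow> \<rho> (g \<otimes> h) = \<rho> g \<circ> \<rho> h"

locale faithful_rep = linear_rep +
  assumes rho_inj: "inj_on \<rho> (carrier G)"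

locale basis_indexed = vector_space scale
  for scale :: "'k::field \<Rightarrow> 'v::ab_group_add \<Rightarrow> 'v" +
  fixes e :: "'n::finite \<Rightarrow> 'v"
  assumes e_inj: "inj e"
    and e_indep: "independent (Set.range e)"
    and e_span: "span (Set.range e) = UNIV"

definition coord :: "('k::field \<Rightarrow> 'v::ab_group_add \<Rightarrow> 'v) \<Rightarrow> ('n \<Rightarrow> 'v) \<Rightarrow> 'n \<Rightarrow> 'v \<Rightarrow> 'k"
  where "coord scale e i v = module.representation scale (Set.range e) v (e i)"


section \<open>Polynomials on \<open>V\<close>\<close>

text \<open>
  The symmetric algebra \<open>k[V]\<close> of \<open>V\<^sup>*\<close> is the polynomial ring over \<open>k\<close> in the coordinates
  with respect to a basis \<open>e\<close> of \<open>V\<close>; monomials are exponent vectors \<open>'n \<Rightarrow>\<^sub>0 nat\<close>. Over a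
  finite field these are formal polynomials, not the functions they induce.
  The finite index type of the basis has to carry a linear order whenever the fraction field is
  needed: this is what the library uses to show that polynomials form an integral domain.
  No definition below refers to the order.
\<close>

type_synonym ('n, 'k) polynomial = "('n \<Rightarrow>\<^sub>0 nat) \<Rightarrow>\<^sub>0 'k"

definition peval :: "('k::zero \<Rightarrow> 'a::comm_semiring_1) \<Rightarrow> ('n::finite \<Rightarrow> 'a) \<Rightarrow> ('n, 'k) polynomial \<Rightarrow> 'a"
  where "peval c \<sigma> f =
    (\<Sum>m\<in>Poly_Mapping.keys f. c (Poly_Mapping.lookup f m) * (\<Prod>i\<in>UNIV. \<sigma> i ^ Poly_Mapping.lookup m i))"

abbreviation pconst :: "'k::zero \<Rightarrow> ('n, 'k) polynomial"
  where "pconst c \<equiv> Poly_Mapping.single 0 c"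

text \<open>An element \<open>l\<close> of \<open>V\<^sup>*\<close>, viewed as a homogeneous polynomial of degree 1.\<close>

definition linear_form :: "('n::finite \<Rightarrow> 'v) \<Rightarrow> ('v \<Rightarrow> 'k::comm_monoid_add) \<Rightarrow> ('n, 'k) polynomial"
  where "linear_form e l = (\<Sum>j\<in>UNIV. Poly_Mapping.single (Poly_Mapping.single j 1) (l (e j)))"

text \<open>
  \<open>(g f)(v) = f (g\<^sup>-\<^sup>1 v)\<close>: substitute for the \<open>i\<close>-th coordinate the linear form
  \<open>v \<mapsto> coord i (g\<^sup>-\<^sup>1 v)\<close>. See lemma \<open>eval_poly_act\<close> below.
\<close>

definition poly_act ::
  "('g, 'm) monoid_scheme \<Rightarrow> ('k::field \<Rightarrow> 'v::ab_group_add \<Rightarrow> 'v) \<Rightarrow> ('g \<Rightarrow> 'v \<Rightarrow> 'v) \<Rightarrow> ('n::finite \<Rightarrow> 'v)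
    \<Rightarrow> 'g \<Rightarrow> ('n, 'k) polynomial \<Rightarrow> ('n, 'k) polynomial"
  where "poly_act G scale \<rho> e g =
    peval pconst (\<lambda>i. linear_form e (\<lambda>v. coord scale e i (\<rho> (inv\<^bsub>G\<^esub> g) v)))"

definition polys_le :: "nat \<Rightarrow> ('n::finite, 'k::zero) polynomial set"
  where "polys_le d = {f. \<forall>m\<in>Poly_Mapping.keys f. (\<Sum>i\<in>UNIV. Poly_Mapping.lookup m i) \<le> d}"


section \<open>Modules over the group algebra\<close>

text \<open>Scalar multiplication of finitely supported functions, used for both \<open>k[V]\<close> and \<open>kG\<close>.\<close>

definition pscale :: "'k::field \<Rightarrow> ('a \<Rightarrow>\<^sub>0 'k) \<Rightarrow> ('a \<Rightarrow>\<^sub>0 'k)"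
  where "pscale c = Poly_Mapping.map ((*) c)"

definition kG_submodule ::
  "('g, 'm) monoid_scheme \<Rightarrow> ('k::field \<Rightarrow> 'a::ab_group_add \<Rightarrow> 'a) \<Rightarrow> ('g \<Rightarrow> 'a \<Rightarrow> 'a) \<Rightarrow> 'a set \<Rightarrow> bool"
  where "kG_submodule G s act W \<longleftrightarrow>
    module.subspace s W \<and> (\<forall>g\<in>carrier G. \<forall>w\<in>W. act g w \<in> W)"

definition kG_isomorphic ::
  "('g, 'm) monoid_scheme
    \<Rightarrow> ('k::field \<Rightarrow> 'a::ab_group_add \<Rightarrow> 'a) \<Rightarrow> ('g \<Rightarrow> 'a \<Rightarrow> 'a) \<Rightarrow> 'a set
    \<Rightarrow> ('k \<Rightarrow> 'b::ab_group_add \<Rightarrow> 'b) \<Rightarrow> ('g \<Rightarrow> 'b \<Rightarrow> 'b) \<Rightarrow> 'b set \<Rightarrow> bool"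
  where "kG_isomorphic G s act A s' act' B \<longleftrightarrow>
    (\<exists>\<phi>. bij_betw \<phi> A B \<and>
      (\<forall>x\<in>A. \<forall>y\<in>A. \<phi> (x + y) = \<phi> x + \<phi> y) \<and>
      (\<forall>c. \<forall>x\<in>A. \<phi> (s c x) = s' c (\<phi> x)) \<and>
      (\<forall>g\<in>carrier G. \<forall>x\<in>A. \<phi> (act g x) = act' g (\<phi> x)))"

definition regular_carrier :: "('g, 'm) monoid_scheme \<Rightarrow> ('g \<Rightarrow>\<^sub>0 'k::field) set"
  where "regular_carrier G = {a. Poly_Mapping.keys a \<subseteq> carrier G}"

definition regular_act :: "('g, 'm) monoid_scheme \<Rightarrow> 'g \<Rightarrow> ('g \<Rightarrow>\<^sub>0 'k::field) \<Rightarrow> ('g \<Rightarrow>\<^sub>0 'k)"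
  where "regular_act G g a =
    (\<Sum>h\<in>Poly_Mapping.keys a. Poly_Mapping.single (g \<otimes>\<^bsub>G\<^esub> h) (Poly_Mapping.lookup a h))"

definition D_reg ::
  "('g, 'm) monoid_scheme \<Rightarrow> ('k::field \<Rightarrow> 'v::ab_group_add \<Rightarrow> 'v) \<Rightarrow> ('g \<Rightarrow> 'v \<Rightarrow> 'v)
    \<Rightarrow> ('n::finite \<Rightarrow> 'v) \<Rightarrow> nat"
  where "D_reg G scale \<rho> e =
    (LEAST d. \<exists>W \<subseteq> polys_le d.
      kG_submodule G pscale (poly_act G scale \<rho> e) W \<and>
      kG_isomorphic G pscale (poly_act G scale \<rho> e) W
        pscale (regular_act G) (regular_carrier G))"


section \<open>Rational functions\<close>

type_synonym ('n, 'k) ratfun = "('n, 'k) polynomial fract"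

text \<open>The value does not depend on the chosen fraction: see lemma \<open>rat_act_Fract\<close> below.\<close>

definition rat_act ::
  "('g, 'm) monoid_scheme \<Rightarrow> ('k::field \<Rightarrow> 'v::ab_group_add \<Rightarrow> 'v) \<Rightarrow> ('g \<Rightarrow> 'v \<Rightarrow> 'v)
    \<Rightarrow> ('n::{finite,linorder} \<Rightarrow> 'v) \<Rightarrow> 'g \<Rightarrow> ('n, 'k) ratfun \<Rightarrow> ('n, 'k) ratfun"
  where "rat_act G scale \<rho> e g r =
    (THE s. \<exists>p q. q \<noteq> 0 \<and> r = Fract p q \<and>
       s = Fract (poly_act G scale \<rho> e g p) (poly_act G scale \<rho> e g q))"

definition invariant_field ::
  "('g, 'm) monoid_scheme \<Rightarrow> ('k::field \<Rightarrow> 'v::ab_group_add \<Rightarrow> 'v) \<Rightarrow> ('g \<Rightarrow> 'v \<Rightarrow> 'v)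
    \<Rightarrow> ('n::{finite,linorder} \<Rightarrow> 'v) \<Rightarrow> ('n, 'k) ratfun set"
  where "invariant_field G scale \<rho> e = {r. \<forall>g\<in>carrier G. rat_act G scale \<rho> e g r = r}"

definition span_over :: "'a::field set \<Rightarrow> 'a set \<Rightarrow> 'a set"
  where "span_over F S =
    {(\<Sum>s\<in>T. c s * s) | T c. finite T \<and> T \<subseteq> S \<and> (\<forall>s\<in>T. c s \<in> F)}"

definition D_span ::
  "('g, 'm) monoid_scheme \<Rightarrow> ('k::field \<Rightarrow> 'v::ab_group_add \<Rightarrow> 'v) \<Rightarrow> ('g \<Rightarrow> 'v \<Rightarrow> 'v)
    \<Rightarrow> ('n::{finite,linorder} \<Rightarrow> 'v) \<Rightarrow> nat"
  where "D_span G scale \<rho> e =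
    (LEAST d. span_over (invariant_field G scale \<rho> e) ((\<lambda>f. Fract f 1) ` polys_le d) = UNIV)"


section \<open>The actions are well defined\<close>

lemma peval_superset:
  assumes "c 0 = 0" "finite A" "Poly_Mapping.keys f \<subseteq> A"
  shows "peval c \<sigma> f =
    (\<Sum>m\<in>A. c (Poly_Mapping.lookup f m) * (\<Prod>i\<in>UNIV. \<sigma> i ^ Poly_Mapping.lookup m i))"
  unfolding peval_def using assms
  by (intro sum.mono_neutral_left) (auto simp: in_keys_iff)

lemma peval_single:
  assumes "c 0 = 0"
  shows "peval c \<sigma> (Poly_Mapping.single m a) = c a * (\<Prod>i\<in>UNIV. \<sigma> i ^ Poly_Mapping.lookup m i)"
  by (subst peval_superset[where A = "{m}"]) (use assms in auto)

lemma peval_zero [simp]: "peval c \<sigma> 0 = 0"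
  by (simp add: peval_def)

lemma peval_add:
  assumes "c 0 = 0" "\<And>a b. c (a + b) = c a + c b"
  shows "peval c \<sigma> (f + g) = peval c \<sigma> f + peval c \<sigma> g"
proof -
  let ?A = "Poly_Mapping.keys f \<union> Poly_Mapping.keys g"
  have "Poly_Mapping.keys (f + g) \<subseteq> ?A"
    by (rule Poly_Mapping.keys_add)
  then show ?thesis
    using assms(1)
    by (simp add: peval_superset[where A = ?A] lookup_add assms(2) sum.distrib distrib_right)
qed

lemma peval_sum:
  assumes "c 0 = 0" "\<And>a b. c (a + b) = c a + c b"
  shows "peval c \<sigma> (\<Sum>x\<in>A. f x) = (\<Sum>x\<in>A. peval c \<sigma> (f x))"
  by (induction A rule: infinite_finite_induct) (auto simp: peval_add[OF assms])

lemma polynomial_as_sum: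
  "(f :: ('n, 'k::comm_monoid_add) polynomial) =
    (\<Sum>m\<in>Poly_Mapping.keys f. Poly_Mapping.single m (Poly_Mapping.lookup f m))"
  by (rule poly_mapping_eqI)
    (auto simp: lookup_sum lookup_single when_def in_keys_iff sum.delta)

lemma peval_mult:
  fixes c :: "'k::comm_semiring_1 \<Rightarrow> 'a::comm_semiring_1"
  assumes "c 0 = 0" "\<And>a b. c (a + b) = c a + c b" "\<And>a b. c (a * b) = c a * c b"
  shows "peval c \<sigma> (f * g) = peval c \<sigma> f * peval c \<sigma> g"
proof -
  note add = peval_sum[OF assms(1,2)]
  have s: "peval c \<sigma> (Poly_Mapping.single m a * Poly_Mapping.single m' b) =
      peval c \<sigma> (Poly_Mapping.single m a) * peval c \<sigma> (Poly_Mapping.single m' b)" for m m' a b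
    by (simp add: mult_single peval_single[where c = c, OF assms(1)] assms(3) lookup_add power_add
        prod.distrib ac_simps)
  show ?thesis
    by (subst (1 2) polynomial_as_sum[of f], subst (1 2) polynomial_as_sum[of g])
      (simp only: sum_product add s)
qed

lemma pconst_hom:
  "pconst 0 = (0 :: ('n, 'k::comm_semiring_1) polynomial)"
  "pconst (a + b) = (pconst a + pconst b :: ('n, 'k) polynomial)"
  "pconst (a * b) = (pconst a * pconst b :: ('n, 'k) polynomial)"
  "pconst 1 = (1 :: ('n, 'k) polynomial)"
  by (simp_all add: single_add mult_single)

lemma peval_one [simp]: "c 0 = 0 \<Longrightarrow> c 1 = 1 \<Longrightarrow> peval c \<sigma> (1 :: ('n::finite, 'k::comm_semiring_1) polynomial) = 1"
  using peval_single[of c \<sigma> 0 1] by simp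

lemma peval_power:
  fixes c :: "'k::comm_semiring_1 \<Rightarrow> 'a::comm_semiring_1"
  assumes "c 0 = 0" "\<And>a b. c (a + b) = c a + c b" "\<And>a b. c (a * b) = c a * c b" "c 1 = 1"
  shows "peval c \<sigma> (f ^ n) = peval c \<sigma> f ^ n"
  by (induction n) (simp_all add: assms peval_mult)

lemma peval_prod:
  fixes c :: "'k::comm_semiring_1 \<Rightarrow> 'a::comm_semiring_1"
  assumes "c 0 = 0" "\<And>a b. c (a + b) = c a + c b" "\<And>a b. c (a * b) = c a * c b" "c 1 = 1"
  shows "peval c \<sigma> (\<Prod>x\<in>A. f x) = (\<Prod>x\<in>A. peval c \<sigma> (f x))"
  by (induction A rule: infinite_finite_induct) (auto simp: assms peval_mult)

lemma peval_peval:
  fixes c :: "'k::comm_semiring_1 \<Rightarrow> 'a::comm_semiring_1" and f :: "('n::finite, 'k) polynomial"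
    and \<tau> :: "'n \<Rightarrow> ('j::finite, 'k) polynomial"
  assumes "c 0 = 0" "\<And>a b. c (a + b) = c a + c b" "\<And>a b. c (a * b) = c a * c b" "c 1 = 1"
  shows "peval c \<sigma> (peval pconst \<tau> f) = peval c (\<lambda>i. peval c \<sigma> (\<tau> i)) f"
  unfolding peval_def[of pconst \<tau> f]
  by (simp add: peval_sum peval_mult peval_prod peval_power peval_single assms)
    (simp add: peval_def)

lemma prod_power_single:
  "(\<Prod>i\<in>UNIV. \<sigma> i ^ Poly_Mapping.lookup (Poly_Mapping.single j (1::nat)) (i::'n::finite))
    = (\<sigma> j :: 'a::comm_monoid_mult)"
proof -
  have "(\<Prod>i\<in>UNIV. \<sigma> i ^ Poly_Mapping.lookup (Poly_Mapping.single j (1::nat)) i) =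
      (\<Prod>i\<in>UNIV. if j = i then \<sigma> i else 1)"
    by (intro prod.cong) (auto simp: lookup_single when_def)
  then show ?thesis by simp
qed

lemma peval_linear_form:
  assumes "c 0 = 0" "\<And>a b. c (a + b) = c a + c b"
  shows "peval c \<sigma> (linear_form e l) = (\<Sum>j\<in>UNIV. c (l (e j)) * \<sigma> j)"
  unfolding linear_form_def
  by (simp add: peval_sum assms peval_single prod_power_single[unfolded One_nat_def])

lemma (in basis_indexed) coord_sum: "(\<Sum>j\<in>UNIV. scale (coord scale e j v) (e j)) = v"
proof -
  have "(\<Sum>b\<in>Set.range e. scale (representation (Set.range e) v b) b) = v"
    by (rule sum_representation_eq[OF e_indep]) (auto simp: e_span)
  then show ?thesis
    by (simp add: sum.reindex[OF e_inj] coord_def)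
qed

lemma (in basis_indexed) coord_linear_sum:
  "coord scale e i (\<Sum>j\<in>A. scale (a j) (w j)) = (\<Sum>j\<in>A. a j * coord scale e i (w j))"
  unfolding coord_def
  by (subst representation_sum[OF e_indep]) (auto simp: e_span representation_scale[OF e_indep])

lemma (in basis_indexed) coord_basis: "coord scale e i (e j) = (if i = j then 1 else 0)"
  unfolding coord_def
  by (subst representation_basis[OF e_indep]) (use e_inj in \<open>auto dest: injD\<close>)

locale rep_with_basis = linear_rep G scale \<rho> + basis_indexed scale e
  for G :: "('g, 'm) monoid_scheme" (structure)
    and scale :: "'k::field \<Rightarrow> 'v::ab_group_add \<Rightarrow> 'v"
    and \<rho> :: "'g \<Rightarrow> 'v \<Rightarrow> 'v" and e :: "'n::finite \<Rightarrow> 'v"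
begin

lemma coord_rho:
  assumes "g \<in> carrier G"
  shows "coord scale e i (\<rho> g v) = (\<Sum>j\<in>UNIV. coord scale e i (\<rho> g (e j)) * coord scale e j v)"
proof -
  interpret l: Vector_Spaces.linear scale scale "\<rho> g"
    by (rule rho_linear[OF assms])
  have "\<rho> g v = \<rho> g (\<Sum>j\<in>UNIV. scale (coord scale e j v) (e j))"
    by (simp only: coord_sum)
  also have "\<dots> = (\<Sum>j\<in>UNIV. scale (coord scale e j v) (\<rho> g (e j)))"
    by (simp add: l.sum l.scale)
  finally show ?thesis
    by (simp add: coord_linear_sum mult.commute)
qed

lemma eval_poly_act:
  assumes "g \<in> carrier G"
  shows "peval (\<lambda>a. a) (\<lambda>i. coord scale e i v) (poly_act G scale \<rho> e g f) =
    peval (\<lambda>a. a) (\<lambda>i. coord scale e i (\<rho> (inv g) v)) f"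
  unfolding poly_act_def
  by (simp add: peval_peval peval_linear_form coord_rho[of "inv g" _ v] assms)

lemma poly_act_add: "poly_act G scale \<rho> e g (p + q) = poly_act G scale \<rho> e g p + poly_act G scale \<rho> e g q"
  unfolding poly_act_def by (rule peval_add) (simp_all add: pconst_hom)

lemma poly_act_mult: "poly_act G scale \<rho> e g (p * q) = poly_act G scale \<rho> e g p * poly_act G scale \<rho> e g q"
  unfolding poly_act_def by (rule peval_mult) (simp_all add: pconst_hom)

lemma poly_act_zero: "poly_act G scale \<rho> e g 0 = 0"
  by (simp add: poly_act_def)

lemma poly_act_comp:
  assumes "g \<in> carrier G" "h \<in> carrier G"
  shows "poly_act G scale \<rho> e g (poly_act G scale \<rho> e h f) = poly_act G scale \<rho> e (g \<otimes> h) f"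
proof -
  have "peval pconst (\<lambda>i. linear_form e (\<lambda>v. coord scale e i (\<rho> (inv g) v)))
          (linear_form e (\<lambda>v. coord scale e i (\<rho> (inv h) v))) =
        linear_form e (\<lambda>v. coord scale e i (\<rho> (inv (g \<otimes> h)) v))" for i
  proof -
    have "\<rho> (inv (g \<otimes> h)) v = \<rho> (inv h) (\<rho> (inv g) v)" for v
      using assms by (simp add: inv_mult_group rho_mult)
    then have *: "coord scale e i (\<rho> (inv (g \<otimes> h)) v) =
        (\<Sum>j\<in>UNIV. coord scale e i (\<rho> (inv h) (e j)) * coord scale e j (\<rho> (inv g) v))" for v
      using assms coord_rho[of "inv h" i "\<rho> (inv g) v"] by simp
    have sum_single: "Poly_Mapping.single m (\<Sum>j\<in>UNIV. a j) = (\<Sum>j\<in>UNIV. Poly_Mapping.single m (a j))"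
      for m :: "'n \<Rightarrow>\<^sub>0 nat" and a :: "'n \<Rightarrow> 'k"
      by (rule poly_mapping_eqI) (simp add: lookup_sum lookup_single when_def)
    show ?thesis
      by (subst peval_linear_form)
        (simp_all add: pconst_hom, simp add: linear_form_def * sum_single sum_distrib_left mult_single,
         rule sum.swap)
  qed
  then show ?thesis
    unfolding poly_act_def by (simp add: peval_peval pconst_hom)
qed

lemma poly_act_one: "poly_act G scale \<rho> e \<one> f = f"
proof -
  have "linear_form e (\<lambda>v. coord scale e i (\<rho> (inv \<one>) v)) =
      Poly_Mapping.single (Poly_Mapping.single i 1) 1" for i
  proof -
    have "linear_form e (\<lambda>v. coord scale e i (\<rho> (inv \<one>) v)) =
        (\<Sum>j\<in>UNIV. if i = j then Poly_Mapping.single (Poly_Mapping.single j 1) 1 else 0)"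
      unfolding linear_form_def by (intro sum.cong) (auto simp: rho_one coord_basis)
    then show ?thesis by simp
  qed
  then have "poly_act G scale \<rho> e \<one> f =
      peval pconst (\<lambda>i. Poly_Mapping.single (Poly_Mapping.single i 1) 1) f"
    by (simp add: poly_act_def)
  also have "\<dots> = (\<Sum>m\<in>Poly_Mapping.keys f. Poly_Mapping.single m (Poly_Mapping.lookup f m))"
    unfolding peval_def
  proof (intro sum.cong refl)
    fix m :: "'n \<Rightarrow>\<^sub>0 nat"
    have pw: "Poly_Mapping.single (Poly_Mapping.single i (1::nat)) (1::'k) ^ n =
        Poly_Mapping.single (Poly_Mapping.single i n) 1" for i :: 'n and n
      by (induction n) (simp_all add: mult_single flip: single_add)
    have pr: "(\<Prod>i\<in>A. Poly_Mapping.single (u i) (1::'k)) = Poly_Mapping.single (\<Sum>i\<in>A. u i) 1"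
      for A :: "'n set" and u :: "'n \<Rightarrow> 'n \<Rightarrow>\<^sub>0 nat"
      by (induction A rule: infinite_finite_induct) (auto simp: mult_single)
    have m: "(\<Sum>i\<in>UNIV. Poly_Mapping.single i (Poly_Mapping.lookup m i)) = m"
      by (rule poly_mapping_eqI) (simp add: lookup_sum lookup_single when_def)
    show "pconst (Poly_Mapping.lookup f m) *
        (\<Prod>i\<in>UNIV. Poly_Mapping.single (Poly_Mapping.single i 1) 1 ^ Poly_Mapping.lookup m i) =
        Poly_Mapping.single m (Poly_Mapping.lookup f m)"
      by (simp only: pw pr m mult_single) simp
  qed
  finally show ?thesis
    using polynomial_as_sum[of f] by simp
qed

lemma poly_act_eq_0_iff:
  assumes "g \<in> carrier G"
  shows "poly_act G scale \<rho> e g f = 0 \<longleftrightarrow> f = 0"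
  using poly_act_comp[of "inv g" g f] assms by (auto simp: poly_act_one poly_act_zero)

end

lemma rat_act_Fract:
  fixes e :: "'n::{finite,linorder} \<Rightarrow> 'v::ab_group_add" and q :: "('n, 'k::field) polynomial"
  assumes "rep_with_basis G scale \<rho> e" "g \<in> carrier G" "q \<noteq> 0"
  shows "rat_act G scale \<rho> e g (Fract p q) =
    Fract (poly_act G scale \<rho> e g p) (poly_act G scale \<rho> e g q)"
proof -
  interpret rep_with_basis G scale \<rho> e by fact
  show ?thesis
    unfolding rat_act_def
  proof (rule the_equality)
    show "\<exists>p' q'. q' \<noteq> 0 \<and> Fract p q = Fract p' q' \<and>
        Fract (poly_act G scale \<rho> e g p) (poly_act G scale \<rho> e g q) =
        Fract (poly_act G scale \<rho> e g p') (poly_act G scale \<rho> e g q')"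
      using assms(3) by blast
  next
    fix s
    assume "\<exists>p' q'. q' \<noteq> 0 \<and> Fract p q = Fract p' q' \<and>
        s = Fract (poly_act G scale \<rho> e g p') (poly_act G scale \<rho> e g q')"
    then obtain p' q' where *: "q' \<noteq> 0" "Fract p q = Fract p' q'"
        "s = Fract (poly_act G scale \<rho> e g p') (poly_act G scale \<rho> e g q')" by blast
    from * assms(3) have "p * q' = p' * q"
      by (simp add: eq_fract)
    then have "poly_act G scale \<rho> e g p * poly_act G scale \<rho> e g q' =
        poly_act G scale \<rho> e g p' * poly_act G scale \<rho> e g q"
      by (metis poly_act_mult)
    with * assms show "s = Fract (poly_act G scale \<rho> e g p) (poly_act G scale \<rho> e g q)"
      by (simp add: eq_fract poly_act_eq_0_iff)
  qed
qed

end

theory Submission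
  imports Defs
begin

text \<open>
  Let \<open>F = k(V)\<^sup>G\<close> and let \<open>U = k[V]\<^sub>\<le>\<^sub>d\<close> span \<open>k(V)\<close> over \<open>F\<close>. Then no nonzero family \<open>(c\<^sub>t)\<close> in
  \<open>k(V)\<close> satisfies \<open>\<Sum>t. c\<^sub>t * t w = 0\<close> for all \<open>w \<in> U\<close>. This alone forces \<open>U\<close> to contain a vector with
  trivial annihilator in \<open>R = kG\<close>, over every field \<open>k\<close> and without the Krull-Schmidt theorem:
  choose \<open>u \<in> U\<close> and a left ideal \<open>L\<close> of maximal dimension on which \<open>x \<mapsto> x u\<close> is injective. If \<open>u\<close> has a
  nonzero annihilator, there is a minimal left ideal \<open>S\<close> with \<open>S \<inter> L = 0\<close>. If \<open>S w\<close> is not contained in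
  \<open>L u\<close> for some \<open>w \<in> U\<close>, self-injectivity of \<open>R\<close> allows us to enlarge \<open>L\<close> to \<open>L + S\<close>. Otherwise every
  \<open>S w\<close> lies in \<open>(S R \<inter> L) u\<close>, so \<open>S U\<close> has smaller \<open>k\<close>-dimension than \<open>S R\<close>, and linear algebra over
  \<open>k(V)\<close> produces a family \<open>(c\<^sub>t)\<close> as above.

  Some \<open>d\<close> satisfies the spanning condition: if \<open>\<Sum>i. a\<^sub>i * t f\<^sub>i\<close> is \<open>1\<close> for \<open>t = 1\<close> and \<open>0\<close> for other
  \<open>t \<in> G\<close>, then \<open>y = \<Sum>i. Tr (a\<^sub>i y) * f\<^sub>i\<close> for all \<open>y\<close>. The lower bound compares \<open>|G|\<close> with the number
  \<open>(n + d choose d)\<close> of monomials and uses the inequality of arithmetic and geometric means.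
\<close>

section \<open>Dual families in spaces of functions\<close>

text \<open>Gaussian elimination by induction on the equations \<open>A\<close>: an equation with a
  nonzero entry \<open>M a p\<close> eliminates the unknown \<open>p\<close>, so both cardinalities
  drop by one.\<close>

lemma underdetermined_system:
  fixes M :: "'a \<Rightarrow> 'b \<Rightarrow> 'f::field"
  assumes "finite A" "finite B" "card A < card B"
  shows "\<exists>c. (\<exists>b\<in>B. c b \<noteq> 0) \<and> (\<forall>a\<in>A. (\<Sum>b\<in>B. c b * M a b) = 0)"
  using assms
proof (induction A arbitrary: B M rule: finite_induct)
  case empty
  then obtain b where "b \<in> B" by fastforce
  then show ?case by (intro exI[of _ "\<lambda>_. 1"]) auto
next
  case (insert a A)
  show ?case
  proof (cases "\<forall>b\<in>B. M a b = 0")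
    case True
    from insert obtain c where "\<exists>b\<in>B. c b \<noteq> 0" "\<forall>a\<in>A. (\<Sum>b\<in>B. c b * M a b) = 0"
      using insert.IH[of B M] insert.hyps insert.prems by (metis Suc_lessD card_insert_disjoint)
    then show ?thesis using True by (intro exI[of _ c]) auto
  next
    case False
    then obtain p where p: "p \<in> B" "M a p \<noteq> 0" by blast
    let ?M = "\<lambda>a' b. M a' b - M a b / M a p * M a' p"
    have "card A < card (B - {p})"
      using insert.hyps insert.prems p by (simp add: card_Diff_singleton)
    then obtain c where c: "\<exists>b\<in>B-{p}. c b \<noteq> 0" "\<forall>a'\<in>A. (\<Sum>b\<in>B-{p}. c b * ?M a' b) = 0"
      using insert.IH[of "B - {p}" ?M] insert.prems by auto
    define s where "s = (\<Sum>b\<in>B-{p}. c b * M a b)"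
    \<comment> \<open>The value at \<open>p\<close> is the one that solves equation
      \<open>a\<close>.\<close>
    define c' where "c' = c(p := - s / M a p)"
    have split: "(\<Sum>b\<in>B. c' b * M a' b) = - s / M a p * M a' p + (\<Sum>b\<in>B-{p}. c b * M a' b)" for a'
      using p insert.prems by (subst sum.remove[of B p]) (auto simp: c'_def intro!: sum.cong)
    have "(\<Sum>b\<in>B. c' b * M a' b) = 0" if "a' \<in> A" for a'
    proof -
      have "0 = (\<Sum>b\<in>B-{p}. c b * ?M a' b)" using c that by simp
      also have "\<dots> = (\<Sum>b\<in>B-{p}. c b * M a' b - c b * M a b * (M a' p / M a p))"
        by (intro sum.cong refl) (simp add: right_diff_distrib)
      also have "\<dots> = (\<Sum>b\<in>B-{p}. c b * M a' b) - s * (M a' p / M a p)"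
        by (simp only: sum_subtractf s_def sum_distrib_right)
      finally show ?thesis by (simp add: split)
    qed
    moreover have "(\<Sum>b\<in>B. c' b * M a b) = 0"
      using p by (simp add: split s_def)
    moreover have "\<exists>b\<in>B. c' b \<noteq> 0"
      using c(1) by (auto simp: c'_def)
    ultimately show ?thesis by blast
  qed
qed

text \<open>Vectors indexed by \<open>A\<close> are encoded as functions that vanish off
  \<open>A\<close>, so that equality of vectors is equality of functions.\<close>

definition fun_subspace :: "'a set \<Rightarrow> ('a \<Rightarrow> 'k::field) set \<Rightarrow> bool" where
  "fun_subspace A B \<longleftrightarrow> (\<lambda>_. 0) \<in> B \<and> (\<forall>x\<in>B. \<forall>y\<in>B. (\<lambda>a. x a + y a) \<in> B) \<and>
    (\<forall>c. \<forall>x\<in>B. (\<lambda>a. c * x a) \<in> B) \<and> (\<forall>x\<in>B. \<forall>a. a \<notin> A \<longrightarrow> x a = 0)"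

text \<open>The rows of a reduced echelon form with pivot columns \<open>H\<close>: the coefficients
  of a combination of the rows are its values on \<open>H\<close>.\<close>

definition dual_family :: "'a set \<Rightarrow> ('a \<Rightarrow> 'a \<Rightarrow> 'k::field) \<Rightarrow> ('a \<Rightarrow> 'k) set \<Rightarrow> bool" where
  "dual_family H b B \<longleftrightarrow> (\<forall>h\<in>H. b h \<in> B) \<and> (\<forall>h\<in>H. \<forall>h'\<in>H. b h h' = (if h = h' then 1 else 0))"

lemma
  assumes "fun_subspace A B"
  shows fun_subspace_zero: "(\<lambda>_. 0) \<in> B"
    and fun_subspace_add: "x \<in> B \<Longrightarrow> y \<in> B \<Longrightarrow> (\<lambda>a. x a + y a) \<in> B"
    and fun_subspace_scale: "x \<in> B \<Longrightarrow> (\<lambda>a. c * x a) \<in> B"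
    and fun_subspace_outside: "x \<in> B \<Longrightarrow> a \<notin> A \<Longrightarrow> x a = 0"
  using assms unfolding fun_subspace_def by simp_all

lemma fun_subspace_sum:
  assumes "fun_subspace A B" "\<And>i. i \<in> I \<Longrightarrow> f i \<in> B"
  shows "(\<lambda>a. \<Sum>i\<in>I. c i * f i a) \<in> B"
  using assms(2)
proof (induction I rule: infinite_finite_induct)
  case (insert i I)
  then show ?case
    using fun_subspace_add[OF assms(1) fun_subspace_scale[OF assms(1), of "f i" "c i"]] by simp
qed (use fun_subspace_zero[OF assms(1)] in auto)

lemma fun_subspace_diff:
  assumes "fun_subspace A B" "x \<in> B" "y \<in> B"
  shows "(\<lambda>a. x a - y a) \<in> B"
  using fun_subspace_add[OF assms(1,2) fun_subspace_scale[OF assms(1,3), of "-1"]] by simp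

text \<open>One elimination step: subtracting from \<open>x\<close> the combination with the same
  values on \<open>H\<close> leaves a vector that vanishes on \<open>H\<close> but not at some
  \<open>h0\<close>. Scaled to 1 at \<open>h0\<close>, it is the new row and clears column
  \<open>h0\<close> in the others.\<close>

lemma dual_family_extend:
  assumes A: "finite A" "H \<subseteq> A" and B: "fun_subspace A B" "fun_subspace A B'" "B \<subseteq> B'"
    and b: "dual_family H b B" and x: "x \<in> B'" "x \<noteq> (\<lambda>a. \<Sum>h\<in>H. x h * b h a)"
  shows "\<exists>h0\<in>A - H. \<exists>b'. dual_family (insert h0 H) b' B'"
proof -
  have fin: "finite H" using A finite_subset by blast
  define y where "y = (\<lambda>a. x a - (\<Sum>h\<in>H. x h * b h a))"
  have bB: "b h \<in> B'" if "h \<in> H" for h using b B that by (auto simp: dual_family_def)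
  have y: "y \<in> B'"
    unfolding y_def by (rule fun_subspace_diff[OF B(2) x(1)], rule fun_subspace_sum[OF B(2)], rule bB)
  have y0: "y h = 0" if "h \<in> H" for h
  proof -
    have "(\<Sum>h'\<in>H. x h' * b h' h) = (\<Sum>h'\<in>H. if h' = h then x h' else 0)"
      using b that by (intro sum.cong) (auto simp: dual_family_def)
    then show ?thesis using fin that by (simp add: y_def)
  qed
  obtain h0 where h0: "y h0 \<noteq> 0" using x(2) by (auto simp: y_def fun_eq_iff)
  have "h0 \<in> A" using y B h0 by (auto simp: fun_subspace_def)
  moreover have "h0 \<notin> H" using y0 h0 by auto
  moreover
  define z where "z = (\<lambda>a. (1 / y h0) * y a)"
  have z: "z \<in> B'" unfolding z_def by (rule fun_subspace_scale[OF B(2) y])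
  have zh: "z h0 = 1" "\<And>h. h \<in> H \<Longrightarrow> z h = 0" using h0 y0 by (auto simp: z_def)
  define b' where "b' = (\<lambda>h. if h = h0 then z else (\<lambda>a. b h a - b h h0 * z a))"
  have "(\<lambda>a. b h h0 * z a) \<in> B'" for h by (rule fun_subspace_scale[OF B(2) z])
  then have "dual_family (insert h0 H) b' B'"
    using z zh bB \<open>h0 \<notin> H\<close> b
    by (auto simp: dual_family_def b'_def intro!: fun_subspace_diff[OF B(2)])
  ultimately show ?thesis by blast
qed

text \<open>For finite \<open>A\<close> and a \<open>fun_subspace\<close> \<open>B\<close> this is
  the dimension of \<open>B\<close>, obtained as the largest number of pivots.\<close>

definition fun_rank :: "'a set \<Rightarrow> ('a \<Rightarrow> 'k::field) set \<Rightarrow> nat" where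
  "fun_rank A B = Max (card ` {H. H \<subseteq> A \<and> (\<exists>b. dual_family H b B)})"

lemma
  assumes "finite A"
  shows fun_rank_ge: "H \<subseteq> A \<Longrightarrow> dual_family H b B \<Longrightarrow> card H \<le> fun_rank A B"
    and fun_rank_attained: "\<exists>H b. H \<subseteq> A \<and> dual_family H b B \<and> card H = fun_rank A B"
proof -
  let ?X = "{H. H \<subseteq> A \<and> (\<exists>b. dual_family H b B)}"
  have fin: "finite ?X" using assms by auto
  show "H \<subseteq> A \<Longrightarrow> dual_family H b B \<Longrightarrow> card H \<le> fun_rank A B"
    unfolding fun_rank_def using fin by (intro Max_ge) auto
  have "{} \<in> ?X" by (simp add: dual_family_def)
  then have "fun_rank A B \<in> card ` ?X" 
    unfolding fun_rank_def using fin by (intro Max_in) auto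
  then show "\<exists>H b. H \<subseteq> A \<and> dual_family H b B \<and> card H = fun_rank A B" by auto
qed

lemma fun_rank_le: "finite A \<Longrightarrow> fun_rank A B \<le> card A"
  using fun_rank_attained[of A B] card_mono by metis

text \<open>With a maximal pivot set, a vector that differs from its interpolation on
  \<open>H\<close> would supply one more pivot.\<close>

lemma spanning_dual_family:
  assumes "finite A" "fun_subspace A B"
  obtains H b where "H \<subseteq> A" "dual_family H b B" "card H = fun_rank A B"
    "\<And>x. x \<in> B \<Longrightarrow> x = (\<lambda>a. \<Sum>h\<in>H. x h * b h a)"
proof -
  obtain H b where H: "H \<subseteq> A" "dual_family H b B" "card H = fun_rank A B"
    using fun_rank_attained[OF assms(1)] by blast
  have "x = (\<lambda>a. \<Sum>h\<in>H. x h * b h a)" if x: "x \<in> B" for x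
  proof (rule ccontr)
    assume "x \<noteq> (\<lambda>a. \<Sum>h\<in>H. x h * b h a)"
    then obtain h0 b' where "h0 \<in> A - H" "dual_family (insert h0 H) b' B"
      using dual_family_extend[of A H B B b x] assms H x by blast
    then have "card (insert h0 H) \<le> fun_rank A B" "card (insert h0 H) = Suc (card H)"
      using fun_rank_ge[OF assms(1), of "insert h0 H" b' B] H finite_subset[OF H(1) assms(1)] by auto
    then show False using H by simp
  qed
  with H that show thesis by blast
qed

text \<open>A vector of \<open>B'\<close> outside \<open>B\<close> is no combination of the
  \<open>b h\<close>, so the old pivots survive and a new one is added.\<close>

lemma dual_family_psubset:
  assumes "finite A" "fun_subspace A B" "fun_subspace A B'" "B \<subset> B'"
    and "H \<subseteq> A" "dual_family H b B"
  shows "\<exists>h0\<in>A - H. \<exists>b'. dual_family (insert h0 H) b' B'"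
proof -
  obtain x where x: "x \<in> B'" "x \<notin> B" using assms by blast
  have "(\<lambda>a. \<Sum>h\<in>H. x h * b h a) \<in> B"
    by (rule fun_subspace_sum) (use assms in \<open>auto simp: dual_family_def\<close>)
  with x have "x \<noteq> (\<lambda>a. \<Sum>h\<in>H. x h * b h a)" by metis
  then show ?thesis using dual_family_extend[of A H B B' b x] assms x by blast
qed

text \<open>Strict monotonicity makes ideals of extremal rank extremal for inclusion.\<close>

lemma fun_rank_psubset:
  assumes "finite A" "fun_subspace A B" "fun_subspace A B'" "B \<subset> B'"
  shows "fun_rank A B < fun_rank A B'"
proof -
  obtain H b where H: "H \<subseteq> A" "dual_family H b B" "card H = fun_rank A B"
    using fun_rank_attained[OF assms(1)] by blast
  then obtain h0 b' where "h0 \<in> A - H" "dual_family (insert h0 H) b' B'"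
    using dual_family_psubset[OF assms] by blast
  then show ?thesis
    using fun_rank_ge[OF assms(1), of "insert h0 H" b' B'] H finite_subset[OF H(1) assms(1)] by auto
qed

section \<open>Left ideals of the group algebra\<close>

locale finite_linear_action = group G + vector_space s
  for G :: "('g, 'm) monoid_scheme" (structure)
    and s :: "'k::field \<Rightarrow> 'a::ab_group_add \<Rightarrow> 'a" +
  fixes act :: "'g \<Rightarrow> 'a \<Rightarrow> 'a"
  assumes finite_carrier: "finite (carrier G)"
    and act_add: "g \<in> carrier G \<Longrightarrow> act g (v + w) = act g v + act g w"
    and act_scale: "g \<in> carrier G \<Longrightarrow> act g (s c v) = s c (act g v)"
    and act_one: "act \<one> v = v"
    and act_comp: "g \<in> carrier G \<Longrightarrow> h \<in> carrier G \<Longrightarrow> act g (act h v) = act (g \<otimes> h) v"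
begin

text \<open>The group algebra is represented by functions that vanish outside \<open>carrier G\<close>.\<close>

definition alg_act :: "('g \<Rightarrow> 'k) \<Rightarrow> 'a \<Rightarrow> 'a" where
  "alg_act x w = (\<Sum>g\<in>carrier G. s (x g) (act g w))"

text \<open>The product of the group element \<open>g\<close> with \<open>x\<close> in the group
  algebra.\<close>

definition translate :: "'g \<Rightarrow> ('g \<Rightarrow> 'k) \<Rightarrow> 'g \<Rightarrow> 'k" where
  "translate g x = (\<lambda>h. if h \<in> carrier G then x (inv g \<otimes> h) else 0)"

text \<open>The product of \<open>x\<close> and \<open>a\<close> in the group algebra, with
  \<open>a\<close> as the right factor.\<close>

definition conv :: "('g \<Rightarrow> 'k) \<Rightarrow> ('g \<Rightarrow> 'k) \<Rightarrow> 'g \<Rightarrow> 'k" where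
  "conv x a = (\<lambda>h. if h \<in> carrier G then \<Sum>g\<in>carrier G. x g * a (inv g \<otimes> h) else 0)"

text \<open>Stability under group elements suffices because they span the group algebra over
  \<open>k\<close>.\<close>

definition left_ideal :: "('g \<Rightarrow> 'k) set \<Rightarrow> bool" where
  "left_ideal L \<longleftrightarrow> fun_subspace (carrier G) L \<and> (\<forall>g\<in>carrier G. \<forall>x\<in>L. translate g x \<in> L)"

lemma left_idealD:
  assumes "left_ideal L"
  shows "fun_subspace (carrier G) L" "\<And>g x. g \<in> carrier G \<Longrightarrow> x \<in> L \<Longrightarrow> translate g x \<in> L"
  using assms by (auto simp: left_ideal_def)

section \<open>The group algebra acting on a representation\<close>

lemma sum_carrier_shift:
  assumes "g \<in> carrier G"
  shows "(\<Sum>h\<in>carrier G. f (g \<otimes> h)) = (\<Sum>h\<in>carrier G. f h)"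
proof (rule sum.reindex_bij_witness[of _ "\<lambda>h. inv g \<otimes> h" "\<lambda>h. g \<otimes> h"])
qed (use assms in \<open>simp_all add: m_assoc[symmetric]\<close>)

lemma act_zero: "g \<in> carrier G \<Longrightarrow> act g 0 = 0"
  using act_scale[of g 0 0] by simp

lemma act_sum: "g \<in> carrier G \<Longrightarrow> act g (\<Sum>i\<in>I. f i) = (\<Sum>i\<in>I. act g (f i))"
  by (induction I rule: infinite_finite_induct) (simp_all add: act_add act_zero)

lemma alg_act_zero_left: "alg_act (\<lambda>_. 0) w = 0"
  by (simp add: alg_act_def)

lemma alg_act_add_left: "alg_act (\<lambda>h. x h + y h) w = alg_act x w + alg_act y w"
  by (simp add: alg_act_def scale_left_distrib sum.distrib)

lemma alg_act_diff_left: "alg_act (\<lambda>h. x h - y h) w = alg_act x w - alg_act y w"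
  by (simp add: alg_act_def scale_left_diff_distrib sum_subtractf)

lemma alg_act_scale_left: "alg_act (\<lambda>h. c * x h) w = s c (alg_act x w)"
  by (simp add: alg_act_def scale_sum_right)

lemma alg_act_sum_left: "alg_act (\<lambda>h. \<Sum>i\<in>I. c i * x i h) w = (\<Sum>i\<in>I. s (c i) (alg_act (x i) w))"
  by (induction I rule: infinite_finite_induct)
    (simp_all add: alg_act_zero_left alg_act_add_left alg_act_scale_left)

lemma alg_act_add_right: "alg_act x (v + w) = alg_act x v + alg_act x w"
  by (simp add: alg_act_def act_add scale_right_distrib sum.distrib)

lemma alg_act_translate:
  assumes "g \<in> carrier G"
  shows "alg_act (translate g x) w = act g (alg_act x w)"
proof -
  have "alg_act (translate g x) w = (\<Sum>h\<in>carrier G. s (x (inv g \<otimes> (g \<otimes> h))) (act (g \<otimes> h) w))"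
    unfolding alg_act_def
    by (subst sum_carrier_shift[OF assms, symmetric]) (simp add: translate_def assms)
  then show ?thesis
    using assms by (simp add: alg_act_def act_sum act_scale act_comp m_assoc[symmetric])
qed

lemma conv_eq_sum: "conv x a = (\<lambda>h. \<Sum>g\<in>carrier G. x g * translate g a h)"
  by (auto simp: conv_def translate_def)

lemma alg_act_conv: "alg_act (conv x a) w = alg_act x (alg_act a w)"
proof -
  have "alg_act (conv x a) w = (\<Sum>g\<in>carrier G. s (x g) (alg_act (translate g a) w))"
    unfolding conv_eq_sum by (rule alg_act_sum_left)
  then show ?thesis by (simp add: alg_act_translate alg_act_def[of x])
qed

lemma alg_act_mem:
  assumes "subspace U" "\<And>g w. g \<in> carrier G \<Longrightarrow> w \<in> U \<Longrightarrow> act g w \<in> U" "w \<in> U"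
  shows "alg_act x w \<in> U"
  unfolding alg_act_def using assms by (auto intro!: subspace_sum subspace_scale)

text \<open>The group algebra is injective over itself: the form \<open>x \<mapsto> x \<one>\<close> identifies homomorphisms
  from \<open>L\<close> into the group algebra with linear functionals on \<open>L\<close>, and these extend.\<close>

lemma left_ideal_hom_eq_conv:
  assumes L: "left_ideal L"
    and add: "\<And>x y. x \<in> L \<Longrightarrow> y \<in> L \<Longrightarrow> \<pi> (\<lambda>h. x h + y h) = (\<lambda>h. \<pi> x h + \<pi> y h)"
    and scale: "\<And>c x. x \<in> L \<Longrightarrow> \<pi> (\<lambda>h. c * x h) = (\<lambda>h. c * \<pi> x h)"
    and trans: "\<And>g x. g \<in> carrier G \<Longrightarrow> x \<in> L \<Longrightarrow> \<pi> (translate g x) = translate g (\<pi> x)"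
    and outside: "\<And>x h. x \<in> L \<Longrightarrow> h \<notin> carrier G \<Longrightarrow> \<pi> x h = 0"
  shows "\<exists>a. \<forall>x\<in>L. \<pi> x = conv x a"
proof -
  note Ls = left_idealD[OF L]
  obtain H b where H: "H \<subseteq> carrier G" "dual_family H b L"
    and rep: "\<And>x. x \<in> L \<Longrightarrow> x = (\<lambda>a. \<Sum>h\<in>H. x h * b h a)"
    using spanning_dual_family[OF finite_carrier Ls(1)] by metis
  have finH: "finite H" using H finite_carrier finite_subset by blast
  have bL: "b h \<in> L" if "h \<in> H" for h using H that by (simp add: dual_family_def)
  have \<pi>0: "\<pi> (\<lambda>_. 0) = (\<lambda>_. 0)"
    using scale[OF fun_subspace_zero[OF Ls(1)], of 0] by simp
  have \<pi>_sum: "\<pi> (\<lambda>a. \<Sum>h\<in>I. c h * b h a) = (\<lambda>a. \<Sum>h\<in>I. c h * \<pi> (b h) a)" if "I \<subseteq> H" for c I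
    using finite_subset[OF that finH] that
  proof (induction I rule: finite_induct)
    case (insert i I)
    have "(\<lambda>a. \<Sum>h\<in>I. c h * b h a) \<in> L" "(\<lambda>a. c i * b i a) \<in> L"
      using insert.prems bL by (auto intro!: fun_subspace_sum[OF Ls(1)] fun_subspace_scale[OF Ls(1)])
    then show ?case
      using insert add[of "\<lambda>a. c i * b i a" "\<lambda>a. \<Sum>h\<in>I. c h * b h a"] scale[OF bL, of i "c i"]
      by simp
  qed (simp add: \<pi>0)
  \<comment> \<open>A functional on the whole group algebra extending
    \<open>x \<mapsto> \<pi> x \<one>\<close>: pivots keep the values on the basis of
    \<open>L\<close>, all other coordinates get 0.\<close>
  define \<alpha> where "\<alpha> = (\<lambda>h. if h \<in> H then \<pi> (b h) \<one> else 0)"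
  have \<pi>_one: "\<pi> x \<one> = (\<Sum>g\<in>carrier G. x g * \<alpha> g)" if "x \<in> L" for x
  proof -
    have "\<pi> x \<one> = (\<Sum>h\<in>H. x h * \<pi> (b h) \<one>)"
      by (subst rep[OF that]) (simp add: \<pi>_sum)
    also have "\<dots> = (\<Sum>g\<in>carrier G. x g * \<alpha> g)"
      by (rule sum.mono_neutral_cong_left) (use H finite_carrier in \<open>auto simp: \<alpha>_def\<close>)
    finally show ?thesis .
  qed
  \<comment> \<open>After inversion, the value of \<open>conv x a\<close> at the identity is the
    functional applied to \<open>x\<close>.\<close>
  define a where "a = (\<lambda>h. \<alpha> (inv h))"
  have "\<pi> x h = conv x a h" if x: "x \<in> L" for x h
  proof (cases "h \<in> carrier G")
    case True
    \<comment> \<open>Equivariance reduces the value at \<open>h\<close> to a value at the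
      identity.\<close>
    have "\<pi> x h = translate (inv h) (\<pi> x) \<one>" using True by (simp add: translate_def)
    also have "\<dots> = \<pi> (translate (inv h) x) \<one>" using True x by (simp add: trans)
    also have "\<dots> = (\<Sum>g\<in>carrier G. translate (inv h) x g * \<alpha> g)"
      using True x by (simp add: \<pi>_one Ls(2))
    also have "\<dots> = (\<Sum>g\<in>carrier G. x (h \<otimes> g) * \<alpha> g)"
      using True by (simp add: translate_def)
    also have "\<dots> = (\<Sum>g\<in>carrier G. x (h \<otimes> g) * a (inv (h \<otimes> g) \<otimes> h))"
      using True by (intro sum.cong refl) (simp add: a_def inv_mult_group m_assoc)
    also have "\<dots> = (\<Sum>g\<in>carrier G. x g * a (inv g \<otimes> h))"
      by (rule sum_carrier_shift[OF True])
    finally show ?thesis using True by (simp add: conv_def)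
  next
    case False
    then show ?thesis using x by (simp add: conv_def outside)
  qed
  then show ?thesis by blast
qed

section \<open>Sums of left ideals and their projections\<close>

lemma left_ideal_zero: "left_ideal {\<lambda>_. 0}"
  by (auto simp: left_ideal_def fun_subspace_def translate_def)

lemma translate_add: "translate g (\<lambda>h. x h + y h) = (\<lambda>h. translate g x h + translate g y h)"
  by (auto simp: translate_def)

lemma left_ideal_sum:
  assumes "left_ideal L" "left_ideal S"
  shows "left_ideal {z. \<exists>x\<in>L. \<exists>y\<in>S. z = (\<lambda>h. x h + y h)}" (is "left_ideal ?T")
proof -
  note L = left_idealD[OF assms(1)] and S = left_idealD[OF assms(2)]
  have I: "(\<lambda>h. x h + y h) \<in> ?T" if "x \<in> L" "y \<in> S" for x y
    using that by blast
  show ?thesis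
    unfolding left_ideal_def fun_subspace_def
  proof (intro conjI ballI allI impI)
    show "(\<lambda>_. 0) \<in> ?T"
      using I[OF fun_subspace_zero[OF L(1)] fun_subspace_zero[OF S(1)]] by simp
  next
    fix z z' assume "z \<in> ?T" "z' \<in> ?T"
    then obtain x y x' y' where *: "x \<in> L" "y \<in> S" "x' \<in> L" "y' \<in> S"
      "z = (\<lambda>h. x h + y h)" "z' = (\<lambda>h. x' h + y' h)" by blast
    show "(\<lambda>a. z a + z' a) \<in> ?T"
      using I[OF fun_subspace_add[OF L(1) *(1,3)] fun_subspace_add[OF S(1) *(2,4)]] *(5,6)
      by (simp add: ac_simps)
  next
    fix c z assume "z \<in> ?T"
    then obtain x y where *: "x \<in> L" "y \<in> S" "z = (\<lambda>h. x h + y h)" by blast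
    show "(\<lambda>a. c * z a) \<in> ?T"
      using I[OF fun_subspace_scale[OF L(1) *(1)] fun_subspace_scale[OF S(1) *(2)]] *(3)
      by (simp add: distrib_left)
  next
    fix z a assume "z \<in> ?T" "a \<notin> carrier G"
    then show "z a = 0"
      using fun_subspace_outside[OF L(1)] fun_subspace_outside[OF S(1)] by fastforce
  next
    fix g z assume g: "g \<in> carrier G" and "z \<in> ?T"
    then obtain x y where *: "x \<in> L" "y \<in> S" "z = (\<lambda>h. x h + y h)" by blast
    show "translate g z \<in> ?T"
      using I[OF L(2)[OF g *(1)] S(2)[OF g *(2)]] *(3) by (simp add: translate_add)
  qed
qed

text \<open>The sum of \<open>L\<close> and \<open>S\<close> is direct, so the projection onto
  \<open>L\<close> is a well-defined homomorphism into the group algebra, and hence a right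
  multiplication.\<close>

lemma left_ideal_projections:
  assumes "left_ideal L" "left_ideal S" "L \<inter> S = {\<lambda>_. 0}"
  shows "\<exists>a. \<forall>x\<in>L. \<forall>y\<in>S. conv (\<lambda>h. x h + y h) a = x"
proof -
  note L = left_idealD[OF assms(1)] and S = left_idealD[OF assms(2)]
  let ?T = "{z. \<exists>x\<in>L. \<exists>y\<in>S. z = (\<lambda>h. x h + y h)}"
  define \<pi> where "\<pi> z = (THE x. x \<in> L \<and> (\<exists>y\<in>S. z = (\<lambda>h. x h + y h)))" for z
  have \<pi>: "\<pi> (\<lambda>h. x h + y h) = x" if "x \<in> L" "y \<in> S" for x y
    unfolding \<pi>_def
  proof (rule the_equality)
    fix x' assume "x' \<in> L \<and> (\<exists>y'\<in>S. (\<lambda>h. x h + y h) = (\<lambda>h. x' h + y' h))"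
    then obtain y' where *: "x' \<in> L" "y' \<in> S" "\<And>h. x h + y h = x' h + y' h"
      by (metis (no_types))
    have "(\<lambda>h. x h - x' h) = (\<lambda>h. y' h - y h)"
      using * by (simp add: fun_eq_iff algebra_simps)
    then have "(\<lambda>h. x h - x' h) \<in> L \<inter> S"
      using fun_subspace_diff[OF L(1) that(1) *(1)] fun_subspace_diff[OF S(1) *(2) that(2)] by simp
    then show "x' = x" using assms(3) by (auto simp: fun_eq_iff)
  qed (use that in blast)
  have "\<exists>a. \<forall>z\<in>?T. \<pi> z = conv z a"
  proof (rule left_ideal_hom_eq_conv[OF left_ideal_sum[OF assms(1,2)]])
    fix z z' assume "z \<in> ?T" "z' \<in> ?T"
    then obtain x y x' y' where *: "x \<in> L" "y \<in> S" "x' \<in> L" "y' \<in> S"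
      "z = (\<lambda>h. x h + y h)" "z' = (\<lambda>h. x' h + y' h)" by blast
    then show "\<pi> (\<lambda>h. z h + z' h) = (\<lambda>h. \<pi> z h + \<pi> z' h)"
      using \<pi>[OF fun_subspace_add[OF L(1) *(1,3)] fun_subspace_add[OF S(1) *(2,4)]]
      by (simp add: \<pi> ac_simps)
  next
    fix c z assume "z \<in> ?T"
    then obtain x y where *: "x \<in> L" "y \<in> S" "z = (\<lambda>h. x h + y h)" by blast
    then show "\<pi> (\<lambda>h. c * z h) = (\<lambda>h. c * \<pi> z h)"
      using \<pi>[OF fun_subspace_scale[OF L(1) *(1)] fun_subspace_scale[OF S(1) *(2)]]
      by (simp add: \<pi> distrib_left)
  next
    fix g z assume g: "g \<in> carrier G" and "z \<in> ?T"
    then obtain x y where *: "x \<in> L" "y \<in> S" "z = (\<lambda>h. x h + y h)" by blast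
    then show "\<pi> (translate g z) = translate g (\<pi> z)"
      using \<pi>[OF L(2)[OF g *(1)] S(2)[OF g *(2)]] by (simp add: \<pi> translate_add)
  next
    fix z h assume "z \<in> ?T" "h \<notin> carrier G"
    then show "\<pi> z h = 0"
      using fun_subspace_outside[OF L(1)] by (auto simp: \<pi>)
  qed
  then obtain a where a: "\<And>z. z \<in> ?T \<Longrightarrow> \<pi> z = conv z a" by blast
  have "conv (\<lambda>h. x h + y h) a = x" if "x \<in> L" "y \<in> S" for x y
  proof -
    have "(\<lambda>h. x h + y h) \<in> ?T" using that by blast
    from a[OF this, symmetric] \<pi>[OF that] show ?thesis by (rule trans)
  qed
  then show ?thesis by blast
qed

subsection \<open>Vectors with trivial annihilator\<close>

text \<open>In the application \<iota> embeds polynomials into k(V) and \<open>j\<close> embeds the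
  constants. The hypothesis \<open>nondeg\<close> says that the maps
  \<open>w \<mapsto> \<iota> (act t w)\<close> on \<open>U\<close> are linearly independent over
  that field.\<close>

theorem exists_free_vector:
  fixes \<iota> :: "'a \<Rightarrow> 'f::field" and j :: "'k \<Rightarrow> 'f"
  assumes U: "subspace U" "\<And>g w. g \<in> carrier G \<Longrightarrow> w \<in> U \<Longrightarrow> act g w \<in> U"
    and \<iota>_add: "\<And>v w. \<iota> (v + w) = \<iota> v + \<iota> w"
    and \<iota>_scale: "\<And>c v. \<iota> (s c v) = j c * \<iota> v"
    and j_hom: "j 0 = 0" "j 1 = 1" "\<And>c d. j (c + d) = j c + j d"
    and nondeg: "\<And>c. (\<And>w. w \<in> U \<Longrightarrow> (\<Sum>t\<in>carrier G. c t * \<iota> (act t w)) = 0) \<Longrightarrow>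
      \<forall>t\<in>carrier G. c t = 0"
  shows "\<exists>u\<in>U. \<forall>x. (\<forall>h. h \<notin> carrier G \<longrightarrow> x h = 0) \<longrightarrow> alg_act x u = 0 \<longrightarrow> x = (\<lambda>_. 0)"
proof -
  let ?rk = "fun_rank (carrier G) :: ('g \<Rightarrow> 'k) set \<Rightarrow> nat"
  let ?R = "{x :: 'g \<Rightarrow> 'k. \<forall>h. h \<notin> carrier G \<longrightarrow> x h = 0}"
  note mem = alg_act_mem[OF U]
  have j_sum: "j (sum f I) = (\<Sum>i\<in>I. j (f i))" for f :: "'b \<Rightarrow> 'k" and I
    by (induction I rule: infinite_finite_induct) (simp_all add: j_hom)
  have "\<iota> 0 = 0" using \<iota>_scale[of 0 0] j_hom(1) by simp
  then have \<iota>_sum: "\<iota> (sum f I) = (\<Sum>i\<in>I. \<iota> (f i))" for f :: "'b \<Rightarrow> 'a" and I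
    by (induction I rule: infinite_finite_induct) (simp_all add: \<iota>_add)
  \<comment> \<open>\<open>P L\<close> says that some vector of \<open>U\<close> embeds the ideal
    \<open>L\<close> into the representation. Ranks are bounded by the group order, so a largest
    such \<open>L\<close> exists.\<close>
  define P where "P L \<longleftrightarrow> left_ideal L \<and> (\<exists>u\<in>U. \<forall>x\<in>L. alg_act x u = 0 \<longrightarrow> x = (\<lambda>_. 0))" for L
  have "P {\<lambda>_. 0}" using subspace_0[OF U(1)] left_ideal_zero by (auto simp: P_def)
  moreover have "\<forall>L. P L \<longrightarrow> ?rk L < Suc (card (carrier G))"
    by (simp add: fun_rank_le[OF finite_carrier] less_Suc_eq_le)
  ultimately obtain L where "P L" and L_max: "\<And>L'. P L' \<Longrightarrow> ?rk L' \<le> ?rk L"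
    using ex_has_greatest_nat[of P _ ?rk] by metis
  then obtain u where L: "left_ideal L" and u: "u \<in> U"
    and inj: "\<And>x. x \<in> L \<Longrightarrow> alg_act x u = 0 \<Longrightarrow> x = (\<lambda>_. 0)"
    by (auto simp: P_def)
  note Ls = left_idealD[OF L]
  let ?Lu = "(\<lambda>x. alg_act x u) ` L"
  have "x = (\<lambda>_. 0)" if x: "x \<in> ?R" "alg_act x u = 0" for x
  proof (rule ccontr)
    assume x0: "x \<noteq> (\<lambda>_. 0)"
    define Q where "Q S \<longleftrightarrow> left_ideal S \<and> S \<noteq> {\<lambda>_. 0} \<and> L \<inter> S = {\<lambda>_. 0}" for S
    \<comment> \<open>The annihilator of \<open>u\<close> is a nonzero candidate for
      \<open>Q\<close>; a candidate \<open>S\<close> of least rank is then a minimal left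
      ideal.\<close>
    let ?I = "{x \<in> ?R. alg_act x u = 0}"
    have I: "left_ideal ?I"
      unfolding left_ideal_def fun_subspace_def
    proof (intro conjI ballI allI impI)
      fix g x assume g: "g \<in> carrier G" and x: "x \<in> ?I"
      then show "translate g x \<in> ?I"
        by (auto simp: alg_act_translate act_zero) (simp add: translate_def)
    qed (auto simp: alg_act_zero_left alg_act_add_left alg_act_scale_left)
    have "L \<inter> ?I = {\<lambda>_. 0}"
      using inj fun_subspace_zero[OF Ls(1)] fun_subspace_zero[OF left_idealD(1)[OF I]] by blast
    moreover have "?I \<noteq> {\<lambda>_. 0}"
    proof
      assume *: "?I = {\<lambda>_. 0}"
      have "x \<in> ?I" using x by simp
      then show False unfolding * using x0 by simp
    qed
    ultimately have "Q ?I" unfolding Q_def by (intro conjI I)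
    then obtain S where "Q S" and S_min: "\<forall>S'. Q S' \<longrightarrow> ?rk S \<le> ?rk S'"
      using ex_has_least_nat[of Q ?I ?rk] by blast
    then have S: "left_ideal S" and S0: "S \<noteq> {\<lambda>_. 0}" and LS: "L \<inter> S = {\<lambda>_. 0}"
      by (auto simp: Q_def)
    have not_S_le_L: "\<not> S \<subseteq> L" using LS S0 Int_absorb1[of S L] by auto
    note Ss = left_idealD[OF S]
    have into_Lu: "alg_act y w \<in> ?Lu" if y: "y \<in> S" and w: "w \<in> U" for y w
    proof (rule ccontr)
      assume not: "alg_act y w \<notin> ?Lu"
      \<comment> \<open>A proper subideal of \<open>S\<close>, hence zero by minimality. So
        \<open>S\<close> acts injectively on \<open>w\<close>, and its image meets that of
        \<open>L\<close> on \<open>u\<close> only in 0.\<close>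
      define N where "N = {y \<in> S. alg_act y w \<in> ?Lu}"
      have N_ideal: "left_ideal N"
        unfolding left_ideal_def fun_subspace_def
      proof (intro conjI ballI allI impI)
        show "(\<lambda>_. 0) \<in> N"
          using fun_subspace_zero[OF Ss(1)] fun_subspace_zero[OF Ls(1)]
          by (force simp: N_def alg_act_zero_left)
      next
        fix p q assume "p \<in> N" "q \<in> N"
        then obtain l m where *: "p \<in> S" "q \<in> S" "l \<in> L" "m \<in> L"
          "alg_act p w = alg_act l u" "alg_act q w = alg_act m u" by (auto simp: N_def)
        then have "alg_act (\<lambda>a. p a + q a) w = alg_act (\<lambda>a. l a + m a) u"
          by (simp add: alg_act_add_left)
        then show "(\<lambda>a. p a + q a) \<in> N"
          using fun_subspace_add[OF Ss(1) *(1,2)] fun_subspace_add[OF Ls(1) *(3,4)]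
          by (auto simp: N_def)
      next
        fix c p assume "p \<in> N"
        then obtain l where *: "p \<in> S" "l \<in> L" "alg_act p w = alg_act l u" by (auto simp: N_def)
        then have "alg_act (\<lambda>a. c * p a) w = alg_act (\<lambda>a. c * l a) u"
          by (simp add: alg_act_scale_left)
        then show "(\<lambda>a. c * p a) \<in> N"
          using fun_subspace_scale[OF Ss(1) *(1)] fun_subspace_scale[OF Ls(1) *(2)]
          by (auto simp: N_def)
      next
        fix p a assume "p \<in> N" "a \<notin> carrier G"
        then show "p a = 0" using fun_subspace_outside[OF Ss(1)] by (auto simp: N_def)
      next
        fix g p assume g: "g \<in> carrier G" and "p \<in> N"
        then obtain l where *: "p \<in> S" "l \<in> L" "alg_act p w = alg_act l u" by (auto simp: N_def)
        then have "alg_act (translate g p) w = alg_act (translate g l) u"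
          by (simp add: alg_act_translate g)
        then show "translate g p \<in> N"
          using Ss(2)[OF g *(1)] Ls(2)[OF g *(2)] by (auto simp: N_def)
      qed
      have N_S: "N \<subset> S" using not y by (auto simp: N_def)
      have "?rk N < ?rk S"
        by (rule fun_rank_psubset[OF finite_carrier left_idealD(1)[OF N_ideal] Ss(1) N_S])
      then have "\<not> Q N" using S_min by (meson linorder_not_le)
      moreover have "L \<inter> N = {\<lambda>_. 0}"
        using LS N_S fun_subspace_zero[OF left_idealD(1)[OF N_ideal]] by blast
      ultimately have N: "N = {\<lambda>_. 0}" using N_ideal by (simp add: Q_def)
      \<comment> \<open>Right multiplication by \<open>b\<close> and by \<open>a\<close> projects
        the sum of \<open>L\<close> and \<open>S\<close> onto \<open>L\<close> and onto
        \<open>S\<close>.\<close>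
      obtain b where b: "\<And>l z. l \<in> L \<Longrightarrow> z \<in> S \<Longrightarrow> conv (\<lambda>h. l h + z h) b = l"
        using left_ideal_projections[OF L S LS] by blast
      obtain a where a: "\<And>l z. l \<in> L \<Longrightarrow> z \<in> S \<Longrightarrow> conv (\<lambda>h. l h + z h) a = z"
      proof -
        obtain a where a: "\<forall>z\<in>S. \<forall>l\<in>L. conv (\<lambda>h. z h + l h) a = z"
          using left_ideal_projections[OF S L] LS unfolding Int_commute[of S] by blast
        have "conv (\<lambda>h. l h + z h) a = z" if "l \<in> L" "z \<in> S" for l z
          using a that by (subst add.commute) blast
        then show thesis by (rule that)
      qed
      \<comment> \<open>With this vector, \<open>l + p\<close> acts as \<open>l\<close> on
        \<open>u\<close> plus \<open>p\<close> on \<open>w\<close>, which is injective on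
        \<open>L + S\<close> and contradicts the maximality of \<open>L\<close>.\<close>
      let ?u = "alg_act b u + alg_act a w"
      let ?T = "{z. \<exists>x\<in>L. \<exists>y\<in>S. z = (\<lambda>h. x h + y h)}"
      have "?u \<in> U" using u w mem subspace_add[OF U(1)] by blast
      moreover have "z = (\<lambda>_. 0)" if z: "z \<in> ?T" "alg_act z ?u = 0" for z
      proof -
        obtain l p where lp: "l \<in> L" "p \<in> S" "z = (\<lambda>h. l h + p h)" using z by blast
        have "alg_act z ?u = alg_act l u + alg_act p w"
          using a[OF lp(1,2)] b[OF lp(1,2)] lp(3)
          by (simp add: alg_act_add_right flip: alg_act_conv)
        then have eq: "alg_act l u + alg_act p w = 0" using z by simp
        then have "alg_act p w = alg_act (\<lambda>h. (-1) * l h) u"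
          unfolding alg_act_scale_left by (simp add: eq_neg_iff_add_eq_0 add.commute)
        then have "p \<in> N"
          using fun_subspace_scale[OF Ls(1) lp(1), of "-1"] lp by (auto simp: N_def)
        then have p: "p = (\<lambda>_. 0)" using N by simp
        then have "l = (\<lambda>_. 0)" using eq inj[OF lp(1)] by (simp add: alg_act_zero_left)
        then show ?thesis using lp p by simp
      qed
      ultimately have "P ?T"
        unfolding P_def using left_ideal_sum[OF L S] by (intro conjI bexI[of _ ?u] ballI impI)
      moreover have "L \<subset> ?T"
      proof -
        have "L \<subseteq> ?T"
        proof
          fix x assume "x \<in> L"
          with fun_subspace_zero[OF Ss(1)] show "x \<in> ?T"
            by (intro CollectI bexI[of _ x] bexI[of _ "\<lambda>_. 0"]) simp_all
        qed
        moreover have "S \<subseteq> ?T"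
        proof
          fix x assume "x \<in> S"
          with fun_subspace_zero[OF Ls(1)] show "x \<in> ?T"
            by (intro CollectI bexI[of _ x] bexI[of _ "\<lambda>_. 0"]) simp_all
        qed
        ultimately show ?thesis using not_S_le_L by blast
      qed
      ultimately show False
        using fun_rank_psubset[OF finite_carrier Ls(1) left_idealD(1)[OF left_ideal_sum[OF L S]]]
          L_max[of ?T] by (meson linorder_not_le)
    qed
    \<comment> \<open>\<open>B\<close> is the two-sided ideal \<open>S R\<close>.\<close>
    define B where "B = {b. \<exists>x. (\<forall>t. x t \<in> S) \<and>
      b = (\<lambda>h. if h \<in> carrier G then \<Sum>t\<in>carrier G. x t (h \<otimes> t) else 0)}"
    have B: "fun_subspace (carrier G) B"
      unfolding fun_subspace_def
    proof (intro conjI ballI allI impI)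
      show "(\<lambda>_. 0) \<in> B"
        using fun_subspace_zero[OF Ss(1)] unfolding B_def
        by (intro CollectI exI[of _ "\<lambda>_ _. 0"]) auto
    next
      fix p q assume "p \<in> B" "q \<in> B"
      then obtain x y where *: "\<And>t. x t \<in> S" "\<And>t. y t \<in> S"
        "p = (\<lambda>h. if h \<in> carrier G then \<Sum>t\<in>carrier G. x t (h \<otimes> t) else 0)"
        "q = (\<lambda>h. if h \<in> carrier G then \<Sum>t\<in>carrier G. y t (h \<otimes> t) else 0)"
        by (auto simp: B_def)
      then show "(\<lambda>a. p a + q a) \<in> B"
        unfolding B_def
        by (intro CollectI exI[of _ "\<lambda>t h. x t h + y t h"])
          (auto simp: sum.distrib intro: fun_subspace_add[OF Ss(1)])
    next
      fix c p assume "p \<in> B"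
      then obtain x where *: "\<And>t. x t \<in> S"
        "p = (\<lambda>h. if h \<in> carrier G then \<Sum>t\<in>carrier G. x t (h \<otimes> t) else 0)"
        by (auto simp: B_def)
      then show "(\<lambda>a. c * p a) \<in> B"
        unfolding B_def
        by (intro CollectI exI[of _ "\<lambda>t h. c * x t h"])
          (auto simp: sum_distrib_left intro: fun_subspace_scale[OF Ss(1)])
    qed (auto simp: B_def)
    have "S \<subseteq> B"
    proof
      fix y assume y: "y \<in> S"
      let ?x = "\<lambda>t. if t = \<one> then y else (\<lambda>_. 0)"
      have "(\<Sum>t\<in>carrier G. ?x t (h \<otimes> t)) = y h" if "h \<in> carrier G" for h
      proof -
        have "(\<Sum>t\<in>carrier G. ?x t (h \<otimes> t)) = (\<Sum>t\<in>carrier G. if t = \<one> then y h else 0)"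
          using that by (intro sum.cong) auto
        then show ?thesis using finite_carrier by simp
      qed
      then show "y \<in> B"
        using y fun_subspace_zero[OF Ss(1)] fun_subspace_outside[OF Ss(1) y]
        unfolding B_def by (intro CollectI exI[of _ ?x]) auto
    qed
    then have LB: "L \<inter> B \<subset> B" using not_S_le_L by blast
    have LB_sub: "fun_subspace (carrier G) (L \<inter> B)"
      using Ls(1) B by (simp add: fun_subspace_def)
    obtain H b where H: "H \<subseteq> carrier G" "dual_family H b (L \<inter> B)"
      and rep: "\<And>x. x \<in> L \<inter> B \<Longrightarrow> x = (\<lambda>a. \<Sum>h\<in>H. x h * b h a)"
      using spanning_dual_family[OF finite_carrier LB_sub] by metis
    \<comment> \<open>Since \<open>S\<close> lies in \<open>B\<close> but not in \<open>L\<close>,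
      the intersection \<open>L \<inter> B\<close> is proper in \<open>B\<close>, which gives one
      pivot beyond \<open>H\<close>.\<close>
    obtain h0 b' where h0: "h0 \<in> carrier G - H" and b': "dual_family (insert h0 H) b' B"
      using dual_family_psubset[OF finite_carrier LB_sub B LB H] by blast
    let ?H = "insert h0 H"
    have fin: "finite H" "finite ?H" using H finite_carrier finite_subset by auto
    have HG: "h \<in> carrier G" if "h \<in> ?H" for h using that h0 H by auto
    \<comment> \<open>There is one equation for each basis vector of \<open>L \<inter> B\<close> and
      one more unknown than equations.\<close>
    obtain c where c: "\<exists>h\<in>?H. c h \<noteq> 0"
      "\<And>a. a \<in> H \<Longrightarrow> (\<Sum>h\<in>?H. c h * \<iota> (act (inv h) (alg_act (b a) u))) = 0"
      using underdetermined_system[OF fin, of "\<lambda>a h. \<iota> (act (inv h) (alg_act (b a) u))"] h0 fin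
      by auto
    have ann: "(\<Sum>h\<in>?H. c h * \<iota> (act (inv h) (alg_act y w))) = 0" if y: "y \<in> S" and w: "w \<in> U" for y w
    proof -
      \<comment> \<open>By injectivity on \<open>L\<close>, the element \<open>l\<close> is unique.
        Thus \<pi> is a homomorphism from \<open>S\<close> to \<open>L\<close> and, by
        self-injectivity, a right multiplication.\<close>
      define \<pi> where "\<pi> z = (SOME l. l \<in> L \<and> alg_act l u = alg_act z w)" for z
      have "\<exists>l. l \<in> L \<and> alg_act l u = alg_act z w" if "z \<in> S" for z
        using into_Lu[OF that w] by fastforce
      then have \<pi>: "\<pi> z \<in> L" "alg_act (\<pi> z) u = alg_act z w" if "z \<in> S" for z
        using someI_ex[of "\<lambda>l. l \<in> L \<and> alg_act l u = alg_act z w"] that unfolding \<pi>_def by auto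
      have \<pi>_eq: "\<pi> z = l" if "z \<in> S" "l \<in> L" "alg_act l u = alg_act z w" for z l
        using inj[OF fun_subspace_diff[OF Ls(1) \<pi>(1)[OF that(1)] that(2)]] \<pi>(2)[OF that(1)] that
        by (simp add: alg_act_diff_left fun_eq_iff)
      obtain a where a: "\<And>z. z \<in> S \<Longrightarrow> \<pi> z = conv z a"
      proof -
        have "\<exists>a. \<forall>z\<in>S. \<pi> z = conv z a"
        proof (rule left_ideal_hom_eq_conv[OF S])
          fix p q assume "p \<in> S" "q \<in> S"
          then show "\<pi> (\<lambda>h. p h + q h) = (\<lambda>h. \<pi> p h + \<pi> q h)"
            by (intro \<pi>_eq fun_subspace_add[OF Ss(1)] fun_subspace_add[OF Ls(1)] \<pi>)
              (simp_all add: alg_act_add_left \<pi>)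
        next
          fix d p assume "p \<in> S"
          then show "\<pi> (\<lambda>h. d * p h) = (\<lambda>h. d * \<pi> p h)"
            by (intro \<pi>_eq fun_subspace_scale[OF Ss(1)] fun_subspace_scale[OF Ls(1)] \<pi>)
              (simp_all add: alg_act_scale_left \<pi>)
        next
          fix g p assume "g \<in> carrier G" "p \<in> S"
          then show "\<pi> (translate g p) = translate g (\<pi> p)"
            by (intro \<pi>_eq Ss(2) Ls(2) \<pi>) (simp_all add: alg_act_translate \<pi>)
        next
          fix p h assume "p \<in> S" "h \<notin> carrier G"
          then show "\<pi> p h = 0" using fun_subspace_outside[OF Ls(1) \<pi>(1)] by blast
        qed
        then show thesis using that by blast
      qed
      \<comment> \<open>The product is a combination of the right translates
        \<open>h \<mapsto> y (h \<otimes> t)\<close> with coefficients \<open>a (inv t)\<close>, the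
        form required by \<open>B\<close>. Hence \<pi> sends \<open>y\<close> into
        \<open>L \<inter> B\<close>, on which \<open>c\<close> was chosen to vanish.\<close>
      have "conv y a \<in> B"
      proof -
        have "conv y a h = (\<Sum>t\<in>carrier G. a (inv t) * y (h \<otimes> t))" if h: "h \<in> carrier G" for h
        proof -
          have "conv y a h = (\<Sum>t\<in>carrier G. y t * a (inv t \<otimes> h))" using h by (simp add: conv_def)
          also have "\<dots> = (\<Sum>t\<in>carrier G. y (h \<otimes> t) * a (inv (h \<otimes> t) \<otimes> h))"
            by (rule sum_carrier_shift[OF h, symmetric])
          finally show ?thesis
            using h by (simp add: inv_mult_group m_assoc mult.commute cong: sum.cong)
        qed
        moreover have "conv y a h = 0" if "h \<notin> carrier G" for h using that by (simp add: conv_def)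
        ultimately show ?thesis
          using fun_subspace_scale[OF Ss(1) y]
          unfolding B_def by (intro CollectI exI[of _ "\<lambda>t h. a (inv t) * y h"]) auto
      qed
      then have l: "\<pi> y \<in> L \<inter> B" using a \<pi> y by simp
      have "alg_act y w = alg_act (\<lambda>a. \<Sum>h\<in>H. \<pi> y h * b h a) u"
        using \<pi>(2)[OF y] rep[OF l] by simp
      then have "alg_act y w = (\<Sum>a\<in>H. s (\<pi> y a) (alg_act (b a) u))"
        by (simp only: alg_act_sum_left)
      then have "(\<Sum>h\<in>?H. c h * \<iota> (act (inv h) (alg_act y w))) =
          (\<Sum>h\<in>?H. \<Sum>a\<in>H. j (\<pi> y a) * (c h * \<iota> (act (inv h) (alg_act (b a) u))))"
        using HG by (intro sum.cong refl)
          (simp add: act_sum act_scale \<iota>_sum \<iota>_scale sum_distrib_left mult.left_commute)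
      also have "\<dots> = (\<Sum>a\<in>H. j (\<pi> y a) * (\<Sum>h\<in>?H. c h * \<iota> (act (inv h) (alg_act (b a) u))))"
        by (subst sum.swap) (simp only: sum_distrib_left)
      also have "\<dots> = 0" using c(2) by simp
      finally show ?thesis .
    qed
    \<comment> \<open>Expanding \<open>alg_act y w\<close> turns \<open>ann\<close> into a relation
      among the \<iota>\<open>(act t w)\<close>; nondegeneracy kills every coefficient.\<close>
    have zero: "\<forall>t\<in>carrier G. (\<Sum>h\<in>?H. c h * j (y (h \<otimes> t))) = 0" if y: "y \<in> S" for y
    proof (rule nondeg)
      fix w assume w: "w \<in> U"
      have "(\<Sum>t\<in>carrier G. (\<Sum>h\<in>?H. c h * j (y (h \<otimes> t))) * \<iota> (act t w)) =
          (\<Sum>h\<in>?H. c h * (\<Sum>t\<in>carrier G. j (y (h \<otimes> t)) * \<iota> (act t w)))"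
        by (simp only: sum_distrib_left sum_distrib_right mult.assoc) (rule sum.swap)
      also have "\<dots> = (\<Sum>h\<in>?H. c h * \<iota> (act (inv h) (alg_act y w)))"
      proof (intro sum.cong refl arg_cong2[of _ _ _ _ "(*)"])
        fix h assume "h \<in> ?H"
        then have h: "h \<in> carrier G" by (rule HG)
        have "\<iota> (act (inv h) (alg_act y w)) = \<iota> (alg_act (translate (inv h) y) w)"
          by (simp add: alg_act_translate h)
        also have "\<dots> = (\<Sum>t\<in>carrier G. j (y (h \<otimes> t)) * \<iota> (act t w))"
          by (simp add: alg_act_def \<iota>_sum \<iota>_scale translate_def h)
        finally show "(\<Sum>t\<in>carrier G. j (y (h \<otimes> t)) * \<iota> (act t w)) =
          \<iota> (act (inv h) (alg_act y w))" ..
      qed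
      finally show "(\<Sum>t\<in>carrier G. (\<Sum>h\<in>?H. c h * j (y (h \<otimes> t))) * \<iota> (act t w)) = 0"
        using ann[OF y w] by simp
    qed
    have zeroB: "(\<Sum>h\<in>?H. c h * j (y h)) = 0" if "y \<in> B" for y
    proof -
      obtain x where x: "\<And>t. x t \<in> S"
        "y = (\<lambda>h. if h \<in> carrier G then \<Sum>t\<in>carrier G. x t (h \<otimes> t) else 0)"
        using \<open>y \<in> B\<close> by (auto simp: B_def)
      have "(\<Sum>h\<in>?H. c h * j (y h)) = (\<Sum>h\<in>?H. \<Sum>t\<in>carrier G. c h * j (x t (h \<otimes> t)))"
        using HG x(2) by (intro sum.cong refl) (simp add: j_sum sum_distrib_left)
      also have "\<dots> = (\<Sum>t\<in>carrier G. \<Sum>h\<in>?H. c h * j (x t (h \<otimes> t)))"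
        by (rule sum.swap)
      also have "\<dots> = 0" using zero x(1) by simp
      finally show ?thesis .
    qed
    obtain p where p: "p \<in> ?H" "c p \<noteq> 0" using c(1) by blast
    \<comment> \<open>The functional given by \<open>c\<close> vanishes on all of \<open>B\<close>,
      but the dual vector at the pivot \<open>p\<close> detects \<open>c p\<close>.\<close>
    have "(\<Sum>h\<in>?H. c h * j (b' p h)) = (\<Sum>h\<in>?H. if h = p then c h else 0)"
      using b' p by (intro sum.cong refl) (auto simp: dual_family_def j_hom)
    also have "\<dots> = c p" using fin(2) p(1) by simp
    finally show False using zeroB[of "b' p"] b' p by (auto simp: dual_family_def)
  qed
  then show ?thesis using u by blast
qed

end

section \<open>Polynomials of bounded degree\<close>

lemma lookup_pscale: "Poly_Mapping.lookup (pscale c f) m = c * Poly_Mapping.lookup f m"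
  unfolding pscale_def by (simp add: Poly_Mapping.map.rep_eq when_def)

lemma pscale_zero: "pscale 0 f = 0"
  by (rule poly_mapping_eqI) (simp add: lookup_pscale)

lemma vector_space_pscale: "vector_space (pscale :: 'k::field \<Rightarrow> ('a \<Rightarrow>\<^sub>0 'k) \<Rightarrow> _)"
  by unfold_locales (auto intro!: poly_mapping_eqI simp: lookup_pscale lookup_add algebra_simps)

text \<open>This turns linearity over \<open>k\<close> into multiplicativity of substitution and of
  the embedding into fractions.\<close>

lemma pscale_eq_mult: "pscale c f = pconst c * (f :: ('n, 'k::field) polynomial)"
proof -
  have "pscale c (Poly_Mapping.single m a) = pconst c * (Poly_Mapping.single m a :: ('n, 'k) polynomial)" for m a
    by (rule poly_mapping_eqI) (simp add: lookup_pscale mult_single lookup_single when_def)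
  moreover have "pscale c (\<Sum>m\<in>A. g m) = (\<Sum>m\<in>A. pscale c (g m))" for A and g :: "('n \<Rightarrow>\<^sub>0 nat) \<Rightarrow> ('n, 'k) polynomial"
    by (rule poly_mapping_eqI) (simp add: lookup_pscale lookup_sum sum_distrib_left)
  ultimately show ?thesis
    by (subst (1 2) polynomial_as_sum[of f]) (simp add: sum_distrib_left)
qed

lemma polys_le_iff: "f \<in> polys_le d \<longleftrightarrow>
    (\<forall>m. Poly_Mapping.lookup f m \<noteq> 0 \<longrightarrow> (\<Sum>i\<in>UNIV. Poly_Mapping.lookup m i) \<le> d)"
  by (auto simp: polys_le_def in_keys_iff)

lemma polys_le_0 [simp]: "0 \<in> polys_le d"
  by (simp add: polys_le_def)

lemma polys_le_mono: "d \<le> d' \<Longrightarrow> polys_le d \<subseteq> polys_le d'"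
  by (auto simp: polys_le_def)

lemma polys_le_add: "f \<in> polys_le d \<Longrightarrow> g \<in> polys_le d \<Longrightarrow> f + g \<in> polys_le d"
  unfolding polys_le_iff lookup_add by (metis add.right_neutral)

lemma polys_le_sum: "(\<And>i. i \<in> I \<Longrightarrow> f i \<in> polys_le d) \<Longrightarrow> sum f I \<in> polys_le d"
  by (induction I rule: infinite_finite_induct) (simp_all add: polys_le_add)

lemma polys_le_mult:
  fixes f g :: "('n::finite, 'k::comm_semiring_1) polynomial"
  assumes "f \<in> polys_le a" "g \<in> polys_le b"
  shows "f * g \<in> polys_le (a + b)"
  unfolding polys_le_def
proof (intro CollectI ballI)
  fix m assume "m \<in> Poly_Mapping.keys (f * g)"
  then obtain p q where "m = p + q" "p \<in> Poly_Mapping.keys f" "q \<in> Poly_Mapping.keys g"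
    using keys_mult by blast
  then show "(\<Sum>i\<in>UNIV. Poly_Mapping.lookup m i) \<le> a + b"
    using assms by (auto simp: polys_le_def lookup_add sum.distrib intro: add_mono)
qed

lemma polys_le_const: "pconst c \<in> polys_le d"
  by (auto simp: polys_le_def)

lemma polys_le_prod:
  fixes f :: "'i \<Rightarrow> ('n::finite, 'k::comm_semiring_1) polynomial"
  assumes "\<And>i. i \<in> I \<Longrightarrow> f i \<in> polys_le (d i)"
  shows "prod f I \<in> polys_le (sum d I)"
  using assms
proof (induction I rule: infinite_finite_induct)
  case (insert i I)
  then show ?case using polys_le_mult[of "f i" "d i" "prod f I" "sum d I"] by simp
qed (simp_all add: polys_le_def)

lemma polys_le_power:
  fixes f :: "('n::finite, 'k::comm_semiring_1) polynomial"
  shows "f \<in> polys_le d \<Longrightarrow> f ^ n \<in> polys_le (n * d)"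
  using polys_le_prod[of "{..<n}" "\<lambda>_. f" "\<lambda>_. d"] by simp

lemma linear_form_polys_le:
  fixes e :: "'n::finite \<Rightarrow> 'v" and l :: "'v \<Rightarrow> 'k::comm_monoid_add"
  shows "linear_form e l \<in> polys_le 1"
proof -
  have "(\<Sum>i\<in>UNIV. Poly_Mapping.lookup (Poly_Mapping.single j (1::nat)) i) = 1" for j :: 'n
    by (simp add: lookup_single when_def)
  then have "Poly_Mapping.single (Poly_Mapping.single j 1) c \<in> polys_le 1" for j :: 'n and c :: 'k
    by (auto simp: polys_le_def)
  then show ?thesis unfolding linear_form_def by (intro polys_le_sum)
qed

text \<open>The action substitutes linear forms for the coordinates, which does not raise the
  degree.\<close>

lemma poly_act_polys_le:
  assumes "f \<in> polys_le d"
  shows "poly_act G scale \<rho> e g f \<in> polys_le d"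
  unfolding poly_act_def peval_def
proof (rule polys_le_sum)
  fix m assume m: "m \<in> Poly_Mapping.keys f"
  let ?l = "\<lambda>i. linear_form e (\<lambda>v. coord scale e i (\<rho> (inv\<^bsub>G\<^esub> g) v))"
  have "pconst (Poly_Mapping.lookup f m) * (\<Prod>i\<in>UNIV. ?l i ^ Poly_Mapping.lookup m i)
      \<in> polys_le (0 + (\<Sum>i\<in>UNIV. Poly_Mapping.lookup m i * 1))"
    by (intro polys_le_mult polys_le_const polys_le_prod polys_le_power linear_form_polys_le)
  then show "pconst (Poly_Mapping.lookup f m) * (\<Prod>i\<in>UNIV. ?l i ^ Poly_Mapping.lookup m i) \<in> polys_le d"
    using m assms polys_le_mono[of "\<Sum>i\<in>UNIV. Poly_Mapping.lookup m i" d] by (auto simp: polys_le_def)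
qed

lemma poly_act_pscale:
  fixes f :: "('n::finite, 'k::field) polynomial"
  shows "poly_act G scale \<rho> e g (pscale c f) = pscale c (poly_act G scale \<rho> e g f)"
proof -
  have "peval pconst \<sigma> (pconst c * f) = pconst c * peval pconst \<sigma> f" for \<sigma> :: "'n \<Rightarrow> ('n, 'k) polynomial"
    by (subst peval_mult) (simp_all add: pconst_hom peval_single)
  then show ?thesis by (simp add: pscale_eq_mult poly_act_def)
qed

lemma poly_act_const: "poly_act G scale \<rho> e g 1 = 1"
  unfolding poly_act_def by (rule peval_one) (simp_all add: pconst_hom)

text \<open>The embedding constructed later runs from the group algebra to polynomials, opposite to
  the direction in \<open>kG_isomorphic\<close>; its inverse inherits all the properties.\<close>

lemma kG_isomorphicI:
  assumes bij: "bij_betw \<psi> B A"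
    and add: "\<And>x y. x \<in> B \<Longrightarrow> y \<in> B \<Longrightarrow> x + y \<in> B \<and> \<psi> (x + y) = \<psi> x + \<psi> y"
    and scale: "\<And>c x. x \<in> B \<Longrightarrow> s' c x \<in> B \<and> \<psi> (s' c x) = s c (\<psi> x)"
    and act: "\<And>g x. g \<in> carrier G \<Longrightarrow> x \<in> B \<Longrightarrow> act' g x \<in> B \<and> \<psi> (act' g x) = act g (\<psi> x)"
  shows "kG_isomorphic G s act A s' act' B"
proof -
  let ?\<phi> = "the_inv_into B \<psi>"
  have inj: "inj_on \<psi> B" and img: "\<psi> ` B = A" using bij by (auto simp: bij_betw_def)
  have inv: "?\<phi> (\<psi> x) = x" if "x \<in> B" for x by (rule the_inv_into_f_f[OF inj that])
  show ?thesis
    unfolding kG_isomorphic_def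
  proof (intro exI[of _ ?\<phi>] conjI ballI allI)
    show "bij_betw ?\<phi> A B" by (rule bij_betw_the_inv_into[OF bij])
  next
    fix x y assume "x \<in> A" "y \<in> A"
    then obtain x' y' where "x' \<in> B" "y' \<in> B" "x = \<psi> x'" "y = \<psi> y'" using img by blast
    then show "?\<phi> (x + y) = ?\<phi> x + ?\<phi> y" using add inv by metis
  next
    fix c x assume "x \<in> A"
    then obtain x' where "x' \<in> B" "x = \<psi> x'" using img by blast
    then show "?\<phi> (s c x) = s' c (?\<phi> x)" using scale inv by metis
  next
    fix g x assume "g \<in> carrier G" "x \<in> A"
    moreover then obtain x' where "x' \<in> B" "x = \<psi> x'" using img by blast
    ultimately show "?\<phi> (act g x) = act' g (?\<phi> x)" using act inv by metis
  qed
qed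

text \<open>In \<open>span_over\<close> each vector occurs once, so the coefficients of equal
  \<open>x i\<close> have to be merged; this is where the partial sums of \<open>c\<close> must lie
  in \<open>F\<close>.\<close>

lemma span_over_sum:
  assumes "finite I" "\<And>i. i \<in> I \<Longrightarrow> x i \<in> S" "\<And>i. i \<in> I \<Longrightarrow> c i \<in> F"
    and "\<And>J. J \<subseteq> I \<Longrightarrow> sum c J \<in> F"
  shows "(\<Sum>i\<in>I. c i * x i) \<in> span_over F S"
proof -
  define c' where "c' y = sum c {i \<in> I. x i = y}" for y
  have "(\<Sum>i\<in>I. c i * x i) = (\<Sum>y\<in>x ` I. \<Sum>i\<in>{i \<in> I. x i = y}. c i * x i)"
    by (rule sum.image_gen[OF assms(1)])
  also have "\<dots> = (\<Sum>y\<in>x ` I. c' y * y)"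
    unfolding c'_def sum_distrib_right by (intro sum.cong refl) auto
  finally show ?thesis
    unfolding span_over_def using assms by (auto simp: c'_def intro!: exI[of _ "x ` I"] exI[of _ c'])
qed

lemma Fract_1_add: "Fract (f + g) 1 = Fract f 1 + Fract g 1"
  and Fract_1_mult: "Fract (f * g) 1 = Fract f 1 * Fract g 1"
  and Fract_1_eq_iff: "Fract f 1 = Fract g 1 \<longleftrightarrow> f = g"
  by (simp_all add: eq_fract)

lemma Fract_1_prod: "Fract (prod f I) 1 = (\<Prod>i\<in>I. Fract (f i) 1)"
  by (induction I rule: infinite_finite_induct) (simp_all add: One_fract_def Fract_1_mult)

section \<open>Polynomials spanning the rational functions\<close>

locale faithful_rep_with_basis = faithful_rep G scale \<rho> + rep_with_basis G scale \<rho> e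
  for G :: "('g, 'm) monoid_scheme" (structure)
    and scale :: "'k::field \<Rightarrow> 'v::ab_group_add \<Rightarrow> 'v"
    and \<rho> :: "'g \<Rightarrow> 'v \<Rightarrow> 'v"
    and e :: "'n::{finite,linorder} \<Rightarrow> 'v" +
  assumes finite_carrier: "finite (carrier G)"
begin

abbreviation "pact \<equiv> poly_act G scale \<rho> e"
abbreviation "ract \<equiv> rat_act G scale \<rho> e"
abbreviation frac :: "('n, 'k) polynomial \<Rightarrow> ('n, 'k) ratfun" where "frac f \<equiv> Fract f 1"

sublocale poly: finite_linear_action G pscale pact
proof -
  interpret p: vector_space "pscale :: 'k \<Rightarrow> ('n, 'k) polynomial \<Rightarrow> _"
    by (rule vector_space_pscale)
  show "finite_linear_action G pscale pact"
    by unfold_locales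
      (simp_all add: finite_carrier poly_act_add poly_act_pscale poly_act_one poly_act_comp)
qed

section \<open>The action on rational functions by field automorphisms\<close>

lemma ract_Fract: "g \<in> carrier G \<Longrightarrow> q \<noteq> 0 \<Longrightarrow> ract g (Fract p q) = Fract (pact g p) (pact g q)"
  by (rule rat_act_Fract[OF rep_with_basis_axioms])

lemma ract_frac: "g \<in> carrier G \<Longrightarrow> ract g (frac f) = frac (pact g f)"
  by (simp add: ract_Fract poly_act_const)

lemma ract_add:
  assumes "g \<in> carrier G"
  shows "ract g (x + y) = ract g x + ract g y"
  by (cases x; cases y) (simp add: assms ract_Fract poly_act_eq_0_iff poly_act_add poly_act_mult)

lemma ract_mult:
  assumes "g \<in> carrier G"
  shows "ract g (x * y) = ract g x * ract g y"
  by (cases x; cases y) (simp add: assms ract_Fract poly_act_eq_0_iff poly_act_mult)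

lemma ract_comp:
  assumes "g \<in> carrier G" "h \<in> carrier G"
  shows "ract g (ract h x) = ract (g \<otimes> h) x"
  by (cases x) (simp add: assms ract_Fract poly_act_eq_0_iff poly_act_comp)

lemma ract_one: "ract \<one> x = x"
  by (cases x) (simp add: ract_Fract poly_act_one)

lemma ract_zero: "g \<in> carrier G \<Longrightarrow> ract g 0 = 0"
  by (simp add: Zero_fract_def ract_frac poly_act_zero)

lemma ract_sum: "g \<in> carrier G \<Longrightarrow> ract g (\<Sum>i\<in>I. f i) = (\<Sum>i\<in>I. ract g (f i))"
  by (induction I rule: infinite_finite_induct) (simp_all add: ract_add ract_zero)

text \<open>An element that fixes every polynomial of degree at most 1 fixes all coordinate
  functions, hence acts trivially on V, against faithfulness.\<close>

lemma moved_coordinate: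
  assumes "g \<in> carrier G" "g \<noteq> \<one>"
  shows "\<exists>f\<in>polys_le 1. pact g f \<noteq> f"
proof (rule ccontr)
  assume *: "\<not> ?thesis"
  let ?X = "\<lambda>i. Poly_Mapping.single (Poly_Mapping.single i 1) 1 :: ('n, 'k) polynomial"
  have X: "linear_form e (\<lambda>v. coord scale e i v) = ?X i" for i
  proof -
    have "linear_form e (\<lambda>v. coord scale e i v) =
        (\<Sum>j\<in>UNIV. if i = j then ?X j else 0)"
      unfolding linear_form_def by (intro sum.cong) (auto simp: coord_basis)
    then show ?thesis by simp
  qed
  have "coord scale e i (\<rho> (inv g) (e j)) = coord scale e i (e j)" for i j
  proof -
    have "pact g (?X i) = linear_form e (\<lambda>v. coord scale e i (\<rho> (inv g) v))"
      by (simp add: poly_act_def peval_single prod_power_single[unfolded One_nat_def] pconst_hom)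
    moreover have "pact g (?X i) = ?X i"
      using * linear_form_polys_le[of e "coord scale e i"] unfolding X by blast
    ultimately have "linear_form e (\<lambda>v. coord scale e i (\<rho> (inv g) v)) =
        linear_form e (\<lambda>v. coord scale e i v)" using X by simp
    then have "Poly_Mapping.lookup (linear_form e (\<lambda>v. coord scale e i (\<rho> (inv g) v))) (Poly_Mapping.single j 1) =
        Poly_Mapping.lookup (linear_form e (\<lambda>v. coord scale e i v)) (Poly_Mapping.single j 1)"
      by simp
    \<comment> \<open>The coefficient at the \<open>j\<close>-th coordinate recovers the value of
      the form at \<open>e j\<close>.\<close>
    moreover have "Poly_Mapping.lookup (linear_form e l) (Poly_Mapping.single j 1) = l (e j)"
      for l :: "'v \<Rightarrow> 'k"
    proof -
      have "Poly_Mapping.lookup (linear_form e l) (Poly_Mapping.single j 1) =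
          (\<Sum>i\<in>UNIV. if i = j then l (e i) else 0)"
        unfolding linear_form_def lookup_sum
      proof (intro sum.cong refl)
        fix i
        have "Poly_Mapping.single i (1::nat) = Poly_Mapping.single j 1 \<longleftrightarrow> i = j"
          by (metis lookup_single_eq lookup_single_not_eq zero_neq_one)
        then show "Poly_Mapping.lookup (Poly_Mapping.single (Poly_Mapping.single i (1::nat)) (l (e i)))
            (Poly_Mapping.single j 1) = (if i = j then l (e i) else 0)"
          by (simp add: lookup_single when_def)
      qed
      then show ?thesis by simp
    qed
    ultimately show ?thesis by simp
  qed
  then have "coord scale e i (\<rho> (inv g) v) = coord scale e i v" for i v
    using assms coord_rho[of "inv g" i v] coord_rho[of \<one> i v] by (simp add: rho_one)
  then have "\<rho> (inv g) v = v" for v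
    using coord_sum[of "\<rho> (inv g) v"] coord_sum[of v] by simp
  then have "\<rho> (inv g) = \<rho> \<one>" by (simp add: rho_one fun_eq_iff)
  then have "inv g = \<one>" using rho_inj assms by (auto dest: inj_onD)
  then show False using assms by (metis inv_inv inv_one)
qed

text \<open>For fixed \<open>g\<^sub>0\<close>, the product over \<open>g \<noteq> g\<^sub>0\<close> of \<open>(t f\<^sub>g - g f\<^sub>g) / (g\<^sub>0 f\<^sub>g - g f\<^sub>g)\<close> is
  \<open>1\<close> at \<open>t = g\<^sub>0\<close> and \<open>0\<close> elsewhere; it is expanded over the subsets of \<open>{g. g \<noteq> g\<^sub>0}\<close>.\<close>

lemma delta_combination:
  assumes g0: "g0 \<in> carrier G"
  shows "\<exists>(I :: 'g set set) a f. finite I \<and> (\<forall>i\<in>I. f i \<in> polys_le (card (carrier G))) \<and>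
    (\<forall>t\<in>carrier G. (\<Sum>i\<in>I. a i * frac (pact t (f i))) = (if t = g0 then 1 else 0))"
proof -
  let ?A = "carrier G - {g0}"
  have "\<exists>f\<in>polys_le 1. pact g0 f \<noteq> pact g f" if g: "g \<in> ?A" for g
  proof -
    \<comment> \<open>A polynomial moved by this quotient takes different values under
      \<open>g0\<close> and \<open>g\<close>.\<close>
    have "inv g0 \<otimes> g \<noteq> \<one>"
      using g g0 by (metis Diff_iff insertI1 inv_equality inv_closed inv_inv)
    then obtain f where f: "f \<in> polys_le 1" "pact (inv g0 \<otimes> g) f \<noteq> f"
      using moved_coordinate[of "inv g0 \<otimes> g"] g g0 by auto
    then have "pact (inv g0) (pact g f) \<noteq> pact (inv g0) (pact g0 f)"
      using g g0 by (simp add: poly_act_comp poly_act_one)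
    then show ?thesis using f(1) by metis
  qed
  then obtain f where f: "\<And>g. g \<in> ?A \<Longrightarrow> f g \<in> polys_le 1 \<and> pact g0 (f g) \<noteq> pact g (f g)"
    by metis
  define D where "D = (\<Prod>g\<in>?A. frac (pact g0 (f g)) - frac (pact g (f g)))"
  have finA: "finite ?A" using finite_carrier by simp
  have "frac (pact g0 (f g)) \<noteq> frac (pact g (f g))" if "g \<in> ?A" for g
    using f[OF that] by (simp add: Fract_1_eq_iff)
  then have D: "D \<noteq> 0"
    unfolding D_def using finA by (simp only: prod_zero_iff right_minus_eq) blast
  define F where "F X = prod f X" for X
  \<comment> \<open>In the expanded product, \<open>X\<close> is the set of factors contributing
    \<open>t f\<^sub>g\<close>; what the other factors and the denominator contribute does not
    depend on \<open>t\<close>.\<close>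
  define a where "a X = (\<Prod>g\<in>?A - X. - frac (pact g (f g))) / D" for X
  have pact_prod: "pact t (prod f X) = (\<Prod>g\<in>X. pact t (f g))" for t X
    by (induction X rule: infinite_finite_induct) (simp_all add: poly_act_const poly_act_mult)
  have "(\<Sum>X\<in>Pow ?A. a X * frac (pact t (F X))) = (if t = g0 then 1 else 0)" if t: "t \<in> carrier G" for t
  proof -
    have "(\<Sum>X\<in>Pow ?A. a X * frac (pact t (F X))) =
        (\<Sum>X\<in>Pow ?A. (\<Prod>g\<in>X. frac (pact t (f g))) * (\<Prod>g\<in>?A - X. - frac (pact g (f g)))) / D"
      by (simp add: a_def F_def pact_prod Fract_1_prod sum_divide_distrib mult.commute)
    also have "\<dots> = (\<Prod>g\<in>?A. frac (pact t (f g)) - frac (pact g (f g))) / D"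
      using prod_add[OF finA, of "\<lambda>g. frac (pact t (f g))" "\<lambda>g. - frac (pact g (f g))"]
      by (simp only: diff_conv_add_uminus)
    also have "\<dots> = (if t = g0 then 1 else 0)"
    proof (cases "t = g0")
      case True
      then show ?thesis using D by (simp add: D_def)
    next
      case False
      then have "(\<Prod>g\<in>?A. frac (pact t (f g)) - frac (pact g (f g))) = 0"
        using t finA by (intro prod_zero bexI[of _ t]) simp_all
      then show ?thesis using False by simp
    qed
    finally show ?thesis .
  qed
  moreover have "F X \<in> polys_le (card (carrier G))" if "X \<in> Pow ?A" for X
  proof -
    have "F X \<in> polys_le (\<Sum>g\<in>X. 1)"
      unfolding F_def by (rule polys_le_prod) (use f that in blast)
    moreover have "card X \<le> card (carrier G)"
      using that finite_carrier by (intro card_mono) auto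
    ultimately show ?thesis using polys_le_mono[of "card X" "card (carrier G)"] by auto
  qed
  ultimately show ?thesis using finA
    by (intro exI[of _ "Pow ?A"] exI[of _ a] exI[of _ F]) simp
qed

lemma invariant_sum: "(\<And>i. i \<in> I \<Longrightarrow> c i \<in> invariant_field G scale \<rho> e) \<Longrightarrow> sum c I \<in> invariant_field G scale \<rho> e"
  by (auto simp: invariant_field_def ract_sum intro: sum.cong)

text \<open>The minimum in \<open>D_span\<close> is therefore taken over a nonempty set. The
  coefficients are traces, which are invariant because left translation permutes the group.\<close>

lemma polys_span_ratfun:
  "span_over (invariant_field G scale \<rho> e) (frac ` polys_le (card (carrier G))) = UNIV"
proof -
  obtain I :: "'g set set" and a f where I: "finite I"
    and f: "\<forall>i\<in>I. f i \<in> polys_le (card (carrier G))"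
    and delta: "\<forall>t\<in>carrier G. (\<Sum>i\<in>I. a i * frac (pact t (f i))) = (if t = \<one> then 1 else 0)"
    using delta_combination[OF one_closed] by blast
  define tr where "tr z = (\<Sum>g\<in>carrier G. ract g z)" for z
  have tr: "tr z \<in> invariant_field G scale \<rho> e" for z
    unfolding invariant_field_def
  proof (intro CollectI ballI)
    fix h assume h: "h \<in> carrier G"
    have "ract h (tr z) = (\<Sum>g\<in>carrier G. ract (h \<otimes> g) z)"
      by (simp add: tr_def ract_sum ract_comp h)
    then show "ract h (tr z) = tr z"
      unfolding tr_def using poly.sum_carrier_shift[OF h, of "\<lambda>g. ract g z"] by simp
  qed
  have "y \<in> span_over (invariant_field G scale \<rho> e) (frac ` polys_le (card (carrier G)))" for y
  proof -
    \<comment> \<open>Writing \<open>f i\<close> as \<open>g\<close> applied to its translate by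
      \<open>inv g\<close> brings it inside the trace; the sum over \<open>i\<close> then leaves
      only the term at the identity.\<close>
    have "(\<Sum>i\<in>I. tr (a i * y) * frac (f i)) =
        (\<Sum>i\<in>I. \<Sum>g\<in>carrier G. ract g (a i * frac (pact (inv g) (f i)) * y))"
      unfolding tr_def sum_distrib_right
    proof (intro sum.cong refl)
      fix i g assume g: "g \<in> carrier G"
      then have "frac (f i) = ract g (frac (pact (inv g) (f i)))"
        by (simp add: ract_frac poly_act_comp poly_act_one)
      then show "ract g (a i * y) * frac (f i) = ract g (a i * frac (pact (inv g) (f i)) * y)"
        using g by (simp add: ract_mult ac_simps)
    qed
    also have "\<dots> = (\<Sum>g\<in>carrier G. \<Sum>i\<in>I. ract g (a i * frac (pact (inv g) (f i)) * y))"
      by (rule sum.swap)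
    also have "\<dots> = (\<Sum>g\<in>carrier G. ract g ((\<Sum>i\<in>I. a i * frac (pact (inv g) (f i))) * y))"
      by (simp add: ract_sum sum_distrib_right)
    also have "\<dots> = (\<Sum>g\<in>carrier G. if g = \<one> then y else 0)"
    proof (intro sum.cong refl)
      fix g assume g: "g \<in> carrier G"
      then have "inv g = \<one> \<longleftrightarrow> g = \<one>" by (metis inv_inv inv_one)
      then show "ract g ((\<Sum>i\<in>I. a i * frac (pact (inv g) (f i))) * y) = (if g = \<one> then y else 0)"
        using g delta[rule_format, of "inv g"] by (simp add: ract_one ract_zero)
    qed
    also have "\<dots> = y" using finite_carrier by simp
    finally have "y = (\<Sum>i\<in>I. tr (a i * y) * frac (f i))" ..
    moreover have "(\<Sum>i\<in>I. tr (a i * y) * frac (f i)) \<in>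
        span_over (invariant_field G scale \<rho> e) (frac ` polys_le (card (carrier G)))"
      using I f by (intro span_over_sum invariant_sum tr) auto
    ultimately show ?thesis by simp
  qed
  then show ?thesis by blast
qed

text \<open>Independence of the group elements as operators on k(V), tested on a spanning set only.
  It supplies the hypothesis \<open>nondeg\<close> of \<open>exists_free_vector\<close>.\<close>

lemma coefficients_eq_zero:
  assumes span: "span_over (invariant_field G scale \<rho> e) (frac ` polys_le d) = UNIV"
    and zero: "\<And>w. w \<in> polys_le d \<Longrightarrow> (\<Sum>t\<in>carrier G. c t * frac (pact t w)) = 0"
    and g0: "g0 \<in> carrier G"
  shows "c g0 = 0"
proof -
  \<comment> \<open>Each group element acts linearly over the invariant field, so the relation
    passes from the spanning polynomials to all of k(V).\<close>
  have all: "(\<Sum>t\<in>carrier G. c t * ract t y) = 0" for y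
  proof -
    have "y \<in> span_over (invariant_field G scale \<rho> e) (frac ` polys_le d)" using span by simp
    then obtain T b where T: "T \<subseteq> frac ` polys_le d" "\<forall>x\<in>T. b x \<in> invariant_field G scale \<rho> e"
      and y: "y = (\<Sum>x\<in>T. b x * x)"
      unfolding span_over_def by blast
    have "(\<Sum>t\<in>carrier G. c t * ract t y) = (\<Sum>t\<in>carrier G. \<Sum>x\<in>T. b x * (c t * ract t x))"
      using T(2) by (intro sum.cong refl)
        (simp add: y ract_sum ract_mult sum_distrib_left invariant_field_def mult.left_commute)
    also have "\<dots> = (\<Sum>x\<in>T. b x * (\<Sum>t\<in>carrier G. c t * ract t x))"
      by (subst sum.swap) (simp add: sum_distrib_left)
    also have "\<dots> = 0"
    proof (intro sum.neutral ballI)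
      fix x assume "x \<in> T"
      then obtain w where "w \<in> polys_le d" "x = frac w" using T by blast
      then show "b x * (\<Sum>t\<in>carrier G. c t * ract t x) = 0"
        using zero[of w] by (simp add: ract_frac)
    qed
    finally show ?thesis .
  qed
  obtain I :: "'g set set" and a f where
    delta: "\<forall>t\<in>carrier G. (\<Sum>i\<in>I. a i * frac (pact t (f i))) = (if t = g0 then 1 else 0)"
    using delta_combination[OF g0] by blast
  \<comment> \<open>The delta combination at \<open>g0\<close> isolates \<open>c g0\<close> from the
    relations at the polynomials \<open>f i\<close>.\<close>
  have "c g0 = (\<Sum>t\<in>carrier G. if t = g0 then c t else 0)" using g0 finite_carrier by simp
  also have "\<dots> = (\<Sum>t\<in>carrier G. c t * (\<Sum>i\<in>I. a i * frac (pact t (f i))))"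
    by (intro sum.cong refl) (simp add: delta)
  also have "\<dots> = (\<Sum>i\<in>I. a i * (\<Sum>t\<in>carrier G. c t * ract t (frac (f i))))"
    unfolding sum_distrib_left
    by (subst sum.swap) (simp add: ract_frac mult.left_commute)
  also have "\<dots> = 0" by (simp add: all)
  finally show ?thesis .
qed

section \<open>Comparison with the regular representation\<close>

lemma polys_le_subspace: "poly.subspace (polys_le d)"
  unfolding poly.subspace_def
  by (auto intro: polys_le_add) (auto simp: polys_le_iff lookup_pscale)

text \<open>Links the group algebra of finitely supported maps with its model by functions: the
  coefficient at \<open>h\<close> comes from \<open>inv g \<otimes> h\<close>.\<close>

lemma lookup_regular_act:
  assumes "g \<in> carrier G" "x \<in> regular_carrier G"
  shows "Poly_Mapping.lookup (regular_act G g x) = poly.translate g (Poly_Mapping.lookup x)"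
proof
  fix h
  have "Poly_Mapping.lookup (regular_act G g x) h =
      (\<Sum>k\<in>Poly_Mapping.keys x. if g \<otimes> k = h then Poly_Mapping.lookup x k else 0)"
    by (simp add: regular_act_def lookup_sum lookup_single when_def)
  also have "\<dots> = (\<Sum>k\<in>Poly_Mapping.keys x. if k = inv g \<otimes> h \<and> h \<in> carrier G then Poly_Mapping.lookup x k else 0)"
  proof (intro sum.cong refl if_cong)
    fix k assume "k \<in> Poly_Mapping.keys x"
    then have "k \<in> carrier G" using assms by (auto simp: regular_carrier_def)
    then show "g \<otimes> k = h \<longleftrightarrow> k = inv g \<otimes> h \<and> h \<in> carrier G"
      using assms by (auto simp: m_assoc[symmetric])
  qed
  also have "\<dots> = poly.translate g (Poly_Mapping.lookup x) h"
    by (cases "h \<in> carrier G") (auto simp: poly.translate_def in_keys_iff)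
  finally show "Poly_Mapping.lookup (regular_act G g x) h = poly.translate g (Poly_Mapping.lookup x) h" .
qed

lemma regular_carrier_iff:
  "x \<in> regular_carrier G \<longleftrightarrow> (\<forall>h. h \<notin> carrier G \<longrightarrow> Poly_Mapping.lookup x h = 0)"
  by (auto simp: regular_carrier_def in_keys_iff)

text \<open>A vector \<open>u\<close> with trivial annihilator makes \<open>x \<mapsto> x u\<close>
  an embedding of the regular representation; degrees stay bounded because the polynomials of degree
  at most \<open>d\<close> are stable under the action.\<close>

lemma span_imp_regular:
  assumes span: "span_over (invariant_field G scale \<rho> e) (frac ` polys_le d) = UNIV"
  shows "\<exists>W \<subseteq> polys_le d. kG_submodule G pscale pact W \<and>
    kG_isomorphic G pscale pact W pscale (regular_act G) (regular_carrier G :: ('g \<Rightarrow>\<^sub>0 'k) set)"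
proof -
  let ?R = "regular_carrier G :: ('g \<Rightarrow>\<^sub>0 'k) set"
  have "\<exists>u\<in>polys_le d. \<forall>x. (\<forall>h. h \<notin> carrier G \<longrightarrow> x h = 0) \<longrightarrow> poly.alg_act x u = 0 \<longrightarrow> x = (\<lambda>_. 0)"
  proof (rule poly.exists_free_vector[where \<iota> = frac and j = "\<lambda>c. frac (pconst c)"])
    show "poly.subspace (polys_le d)" by (rule polys_le_subspace)
    show "pact g w \<in> polys_le d" if "w \<in> polys_le d" for g w
      by (rule poly_act_polys_le[OF that])
    show "frac (v + w) = frac v + frac w" for v w by (rule Fract_1_add)
    show "frac (pscale c v) = frac (pconst c) * frac v" for c v
      by (simp only: pscale_eq_mult Fract_1_mult)
    show "frac (pconst 0) = 0" "frac (pconst 1) = 1"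
      by (simp_all add: Zero_fract_def One_fract_def)
    show "frac (pconst (a + b)) = frac (pconst a) + frac (pconst b)" for a b
      by (simp only: pconst_hom Fract_1_add)
    show "\<forall>t\<in>carrier G. c t = 0"
      if "\<And>w. w \<in> polys_le d \<Longrightarrow> (\<Sum>t\<in>carrier G. c t * frac (pact t w)) = 0" for c
      using coefficients_eq_zero[OF span that] by blast
  qed
  then obtain u where u: "u \<in> polys_le d"
    and inj: "\<And>x. (\<And>h. h \<notin> carrier G \<Longrightarrow> x h = 0) \<Longrightarrow> poly.alg_act x u = 0 \<Longrightarrow> x = (\<lambda>_. 0)"
    by blast
  define \<psi> where "\<psi> x = poly.alg_act (Poly_Mapping.lookup x) u" for x :: "'g \<Rightarrow>\<^sub>0 'k"
  have add: "x + y \<in> ?R \<and> \<psi> (x + y) = \<psi> x + \<psi> y" if "x \<in> ?R" "y \<in> ?R" for x y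
    using that poly.alg_act_add_left[of "Poly_Mapping.lookup x" "Poly_Mapping.lookup y" u]
    by (simp add: regular_carrier_iff lookup_add \<psi>_def plus_poly_mapping.rep_eq)
  have lookup_pscale': "Poly_Mapping.lookup (pscale c x) = (\<lambda>h. c * Poly_Mapping.lookup x h)"
    for c and x :: "'g \<Rightarrow>\<^sub>0 'k" by (simp add: fun_eq_iff lookup_pscale)
  have scale: "pscale c x \<in> ?R \<and> \<psi> (pscale c x) = pscale c (\<psi> x)" if "x \<in> ?R" for c x
    using that by (simp add: regular_carrier_iff \<psi>_def lookup_pscale' poly.alg_act_scale_left)
  have act: "regular_act G g x \<in> ?R \<and> \<psi> (regular_act G g x) = pact g (\<psi> x)"
    if "g \<in> carrier G" "x \<in> ?R" for g x
    using that by (simp add: regular_carrier_iff[of "regular_act G g x"] \<psi>_def lookup_regular_act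
        poly.alg_act_translate) (simp add: poly.translate_def)
  have "inj_on \<psi> ?R"
  proof (rule inj_onI)
    fix x y assume *: "x \<in> ?R" "y \<in> ?R" "\<psi> x = \<psi> y"
    then have "(\<lambda>h. Poly_Mapping.lookup x h - Poly_Mapping.lookup y h) = (\<lambda>_. 0)"
      by (intro inj) (simp_all add: regular_carrier_iff \<psi>_def poly.alg_act_diff_left)
    then show "x = y" by (intro poly_mapping_eqI) (simp add: fun_eq_iff)
  qed
  then have "bij_betw \<psi> ?R (\<psi> ` ?R)" by (rule inj_on_imp_bij_betw)
  then have "kG_isomorphic G pscale pact (\<psi> ` ?R) pscale (regular_act G) ?R"
    using add scale act by (rule kG_isomorphicI)
  moreover have "kG_submodule G pscale pact (\<psi> ` ?R)"
  proof -
    have "\<psi> 0 = 0" using scale[of 0 0] by (simp add: regular_carrier_def pscale_zero)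
    then have "0 \<in> \<psi> ` ?R" by (intro image_eqI[of _ _ 0]) (simp_all add: regular_carrier_def)
    moreover have "\<psi> x + \<psi> y \<in> \<psi> ` ?R" if "x \<in> ?R" "y \<in> ?R" for x y
      using add[OF that] by (intro image_eqI[of _ _ "x + y"]) simp_all
    moreover have "pscale c (\<psi> x) \<in> \<psi> ` ?R" if "x \<in> ?R" for c x
      using scale[OF that] by (intro image_eqI[of _ _ "pscale c x"]) simp_all
    moreover have "pact g (\<psi> x) \<in> \<psi> ` ?R" if "g \<in> carrier G" "x \<in> ?R" for g x
      using act[OF that] by (intro image_eqI[of _ _ "regular_act G g x"]) simp_all
    ultimately show ?thesis
      unfolding kG_submodule_def poly.subspace_def by blast
  qed
  moreover have "\<psi> ` ?R \<subseteq> polys_le d"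
    using poly.alg_act_mem[OF polys_le_subspace _ u] by (auto simp: \<psi>_def poly_act_polys_le)
  ultimately show ?thesis by blast
qed

text \<open>A dimension count. With fewer monomials than group elements, the preimages of the group
  elements satisfy a linear relation, which the isomorphism carries to a relation among the group
  elements themselves.\<close>

lemma order_le_card_monomials:
  assumes W: "W \<subseteq> polys_le d" "kG_submodule G pscale pact W"
    "kG_isomorphic G pscale pact W pscale (regular_act G) (regular_carrier G :: ('g \<Rightarrow>\<^sub>0 'k) set)"
    and fin: "finite {m :: 'n \<Rightarrow>\<^sub>0 nat. (\<Sum>i\<in>UNIV. Poly_Mapping.lookup m i) \<le> d}"
  shows "order G \<le> card {m :: 'n \<Rightarrow>\<^sub>0 nat. (\<Sum>i\<in>UNIV. Poly_Mapping.lookup m i) \<le> d}"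
proof (rule ccontr)
  let ?M = "{m :: 'n \<Rightarrow>\<^sub>0 nat. (\<Sum>i\<in>UNIV. Poly_Mapping.lookup m i) \<le> d}"
  let ?R = "regular_carrier G :: ('g \<Rightarrow>\<^sub>0 'k) set"
  assume "\<not> ?thesis"
  then have less: "card ?M < card (carrier G)" by (simp add: order_def)
  obtain \<phi> where bij: "bij_betw \<phi> W ?R"
    and add: "\<And>x y. x \<in> W \<Longrightarrow> y \<in> W \<Longrightarrow> \<phi> (x + y) = \<phi> x + \<phi> y"
    and scale: "\<And>c x. x \<in> W \<Longrightarrow> \<phi> (pscale c x) = pscale c (\<phi> x)"
    using W(3) unfolding kG_isomorphic_def by blast
  have sub: "poly.subspace W" using W(2) by (simp add: kG_submodule_def)
  have "\<exists>w\<in>W. \<phi> w = Poly_Mapping.single g 1" if "g \<in> carrier G" for g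
  proof -
    have "Poly_Mapping.single g 1 \<in> ?R" using that by (simp add: regular_carrier_def)
    then show ?thesis using bij by (metis bij_betw_def imageE)
  qed
  then obtain w where w: "\<And>g. g \<in> carrier G \<Longrightarrow> w g \<in> W"
    "\<And>g. g \<in> carrier G \<Longrightarrow> \<phi> (w g) = Poly_Mapping.single g 1" by metis
  \<comment> \<open>One equation for each monomial, one unknown for each group element.\<close>
  obtain c g0 where c: "g0 \<in> carrier G" "c g0 \<noteq> 0"
    "\<And>m. m \<in> ?M \<Longrightarrow> (\<Sum>g\<in>carrier G. c g * Poly_Mapping.lookup (w g) m) = 0"
    using underdetermined_system[OF fin finite_carrier less, of "\<lambda>m g. Poly_Mapping.lookup (w g) m"]
    by blast
  have zero: "(\<Sum>g\<in>carrier G. pscale (c g) (w g)) = 0"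
  proof (rule poly_mapping_eqI)
    fix m
    show "Poly_Mapping.lookup (\<Sum>g\<in>carrier G. pscale (c g) (w g)) m = Poly_Mapping.lookup 0 m"
    proof (cases "m \<in> ?M")
      case True
      then show ?thesis using c(3) by (simp add: lookup_sum lookup_pscale)
    next
      case False
      then have "Poly_Mapping.lookup (w g) m = 0" if "g \<in> carrier G" for g
      proof -
        have "w g \<in> polys_le d" using w(1)[OF that] W(1) by blast
        with False show ?thesis by (auto simp: polys_le_iff)
      qed
      then show ?thesis by (simp add: lookup_sum lookup_pscale)
    qed
  qed
  have "\<phi> (\<Sum>g\<in>A. pscale (c g) (w g)) = (\<Sum>g\<in>A. Poly_Mapping.single g (c g))"
    if "A \<subseteq> carrier G" for A
    using finite_subset[OF that finite_carrier] that
  proof (induction A rule: finite_induct)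
    case empty
    show ?case using scale[of 0 0] poly.subspace_0[OF sub] by (simp add: pscale_zero)
  next
    case (insert g A)
    have "pscale (c g) (Poly_Mapping.single g 1) = Poly_Mapping.single g (c g)"
      by (rule poly_mapping_eqI) (simp add: lookup_pscale lookup_single when_def)
    moreover have "(\<Sum>g\<in>A. pscale (c g) (w g)) \<in> W" "pscale (c g) (w g) \<in> W"
      using insert.prems w sub by (auto intro!: poly.subspace_sum poly.subspace_scale)
    ultimately show ?case using insert w by (simp add: add scale)
  qed
  from this[OF order_refl] zero
  have "(\<Sum>g\<in>carrier G. Poly_Mapping.single g (c g)) = \<phi> 0" by simp
  also have "\<phi> 0 = 0" using scale[of 0 0] poly.subspace_0[OF sub] by (simp add: pscale_zero)
  finally have "Poly_Mapping.lookup (\<Sum>g\<in>carrier G. Poly_Mapping.single g (c g)) g0 = 0" by simp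
  then show False using c finite_carrier by (simp add: lookup_sum lookup_single when_def)
qed

end

section \<open>The lower bound\<close>

text \<open>Stars and bars: prepending the slack \<open>d\<close> minus the degree identifies
  monomials with lists of naturals of sum \<open>d\<close>, one entry longer than the number of
  variables.\<close>

lemma
  defines "M d \<equiv> {m :: 'n::finite \<Rightarrow>\<^sub>0 nat. (\<Sum>i\<in>UNIV. Poly_Mapping.lookup m i) \<le> d}"
  shows finite_monomials: "finite (M d)"
    and card_monomials_le: "card (M d) \<le> (card (UNIV :: 'n set) + d) choose d"
proof -
  obtain xs :: "'n list" where xs: "set xs = UNIV" "distinct xs"
    using finite_distinct_list[OF finite_UNIV] by blast
  have len: "length xs = card (UNIV :: 'n set)" using xs distinct_card by metis
  let ?L = "{l :: nat list. length l = card (UNIV :: 'n set) + 1 \<and> sum_list l = d}"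
  define F where "F m = (d - (\<Sum>i\<in>UNIV. Poly_Mapping.lookup m i)) # map (Poly_Mapping.lookup m) xs"
    for m :: "'n \<Rightarrow>\<^sub>0 nat"
  have "inj_on F (M d)"
  proof (rule inj_onI)
    fix m m' assume "F m = F m'"
    then show "m = m'" using xs by (intro poly_mapping_eqI) (simp add: F_def)
  qed
  moreover have "F ` M d \<subseteq> ?L"
    using xs by (auto simp: F_def M_def len sum_list_distinct_conv_sum_set)
  moreover have "?L \<subseteq> {l. set l \<subseteq> {..d} \<and> length l = card (UNIV :: 'n set) + 1}"
    using member_le_sum_list by fastforce
  then have "finite ?L" by (rule finite_subset) (rule finite_lists_length_eq, simp)
  ultimately show "finite (M d)" "card (M d) \<le> (card (UNIV :: 'n set) + d) choose d"
    using card_length_sum_list[of "card (UNIV :: 'n set) + 1" d] card_inj_on_le[of F "M d" ?L]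
      inj_on_finite[of F "M d" ?L] by (simp_all add: add.commute)
qed

text \<open>The left side is the product of \<open>d + i\<close> for \<open>i\<close> from 1 to
  \<open>n\<close>. In its square, \<open>d + i\<close> is paired with
  \<open>d + (n + 1 - i)\<close>; each pair has mean \<open>d + (n + 1) / 2\<close>.\<close>

lemma fact_mult_binomial_le_power:
  "fact n * real ((n + d) choose d) \<le> (real d + (real n + 1) / 2) ^ n"
proof -
  let ?p = "\<Prod>i=1..n. real (d + i)"
  have "fact (n + d) = fact d * ?p"
  proof (induction n)
    case (Suc n)
    have "fact (Suc n + d) = real (d + Suc n) * fact (n + d)" by (simp add: add.commute)
    then show ?case by (simp add: Suc)
  qed simp
  moreover have "fact d * (fact n * real ((n + d) choose d)) = fact (n + d)"
    using arg_cong[OF binomial_fact_lemma[of d "n + d"], of real] by (simp add: mult.assoc)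
  ultimately have "fact d * (fact n * real ((n + d) choose d)) = fact d * ?p"
    by simp
  then have eq: "fact n * real ((n + d) choose d) = ?p" by simp
  have rev: "?p = (\<Prod>i=1..n. real (d + (n + 1 - i)))"
    by (rule prod.reindex_bij_witness[of _ "\<lambda>i. n + 1 - i" "\<lambda>i. n + 1 - i"]) auto
  have "?p ^ 2 = ?p * (\<Prod>i=1..n. real (d + (n + 1 - i)))"
    by (simp only: power2_eq_square rev[symmetric])
  also have "\<dots> = (\<Prod>i=1..n. real (d + i) * real (d + (n + 1 - i)))"
    by (simp only: prod.distrib)
  also have "\<dots> \<le> (\<Prod>i=1..n. (real d + (real n + 1) / 2) ^ 2)"
  proof (intro prod_mono conjI)
    fix i assume "i \<in> {1..n}"
    then have "real (n + 1 - i) = real n + 1 - real i" by (simp add: of_nat_diff)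
    moreover have "0 \<le> (real i - (real n + 1) / 2) ^ 2" by simp
    moreover have "(real d + i) * (real d + (real n + 1 - i)) =
        (real d + (real n + 1) / 2) ^ 2 - (real i - (real n + 1) / 2) ^ 2"
      \<comment> \<open>The identity (m + x)(m - x) = m^2 - x^2, with m the mean and x the distance
        of \<open>i\<close> from \<open>(n + 1) / 2\<close>.\<close>
      by (simp add: power2_eq_square field_simps)
    ultimately show "real (d + i) * real (d + (n + 1 - i)) \<le> (real d + (real n + 1) / 2) ^ 2"
      by (simp only: of_nat_add)
  qed simp
  also have "\<dots> = ((real d + (real n + 1) / 2) ^ n) ^ 2"
    by (simp add: power_mult[symmetric] mult.commute)
  finally have "?p \<le> (real d + (real n + 1) / 2) ^ n"
    by (rule power2_le_imp_le) simp
  then show ?thesis by (simp add: eq)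
qed

theorem corollary4p10:
  fixes G :: "('g, 'm) monoid_scheme"
    and scale :: "'k::field \<Rightarrow> 'v::ab_group_add \<Rightarrow> 'v"
    and \<rho> :: "'g \<Rightarrow> 'v \<Rightarrow> 'v"
    and e :: "'n::{finite,linorder} \<Rightarrow> 'v"
    and n :: nat
  assumes "finite (carrier G)"
    and "faithful_rep G scale \<rho>"
    and "basis_indexed scale e"
    and "vector_space.dim scale (UNIV :: 'v set) = n"
    and "n \<ge> 1"
  shows "D_span G scale \<rho> e \<ge> D_reg G scale \<rho> e \<and>
    real (D_reg G scale \<rho> e) \<ge> root n (fact n * real (order G)) - (real n + 1) / 2"
proof -
  interpret f: faithful_rep G scale \<rho> by fact
  interpret b: basis_indexed scale e by fact
  interpret faithful_rep_with_basis G scale \<rho> e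
    by unfold_locales (rule assms(1))
  \<comment> \<open>The dimension equals the number of coordinates, hence of variables in the
    monomial count.\<close>
  have n: "n = card (UNIV :: 'n set)"
    using f.dim_eq_card[of "range e" UNIV] b.e_indep b.e_span assms(4) card_image[OF b.e_inj]
    by (simp add: f.span_UNIV)
  let ?reg = "\<lambda>d. \<exists>W \<subseteq> polys_le d. kG_submodule G pscale pact W \<and>
    kG_isomorphic G pscale pact W pscale (regular_act G) (regular_carrier G :: ('g \<Rightarrow>\<^sub>0 'k) set)"
  have "span_over (invariant_field G scale \<rho> e) (frac ` polys_le (D_span G scale \<rho> e)) = UNIV"
    unfolding D_span_def by (rule LeastI, rule polys_span_ratfun)
  then have reg: "?reg (D_span G scale \<rho> e)" by (rule span_imp_regular)
  then have le: "D_reg G scale \<rho> e \<le> D_span G scale \<rho> e"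
    unfolding D_reg_def by (rule Least_le)
  \<comment> \<open>The degree \<open>D_span\<close> witnesses that the minimum defining
    \<open>D_reg\<close> is attained.\<close>
  have "?reg (D_reg G scale \<rho> e)"
    unfolding D_reg_def by (rule LeastI[of ?reg, OF reg])
  then obtain W where "W \<subseteq> polys_le (D_reg G scale \<rho> e)" "kG_submodule G pscale pact W"
    "kG_isomorphic G pscale pact W pscale (regular_act G) (regular_carrier G :: ('g \<Rightarrow>\<^sub>0 'k) set)"
    by blast
  from order_le_card_monomials[OF this finite_monomials]
  have "order G \<le> (n + D_reg G scale \<rho> e) choose D_reg G scale \<rho> e"
    unfolding n using card_monomials_le[where 'n = 'n] by (rule order_trans)
  then have "fact n * real (order G) \<le> fact n * real ((n + D_reg G scale \<rho> e) choose D_reg G scale \<rho> e)"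
    by (intro mult_left_mono) simp_all
  also have "\<dots> \<le> (real (D_reg G scale \<rho> e) + (real n + 1) / 2) ^ n"
    by (rule fact_mult_binomial_le_power)
  finally have "root n (fact n * real (order G)) \<le> root n ((real (D_reg G scale \<rho> e) + (real n + 1) / 2) ^ n)"
    using assms(5) by simp
  also have "\<dots> = real (D_reg G scale \<rho> e) + (real n + 1) / 2"
    using assms(5) by (intro real_root_power_cancel) auto
  finally show ?thesis using le by simp
qed

end
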